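(* Let $N\ge3$ be an integer and $p\ge q>0$, $pq>1$, with $q>q_4=\frac{p+2}p$ and $q\ne\frac N{N-1}$. (i) The system $$-\Delta\widetilde u_1+|\nabla\widetilde u_2|^p=0,\qquad -\Delta\widetilde u_2+|\nabla\widetilde u_1|^q=0,\qquad \widetilde u_1,\widetilde u_2\ge0,$$ admits in $\mathbb{R}^N\setminus\{0\}$ the particular radial solution $(\widetilde u_1^*,\widetilde u_2^* )=(A_1^*r^{\frac{p(q-1)-2}{pq-1}},A_2^*r^{\frac{q(p-1)-2}{pq-1}})$, where both components are cusp-solutions. Moreover there exist bounded radial solutions in $\mathbb{R}^N\setminus\{0\}$: • if $q_4<q<\frac N{N-1}$, there exist solutions such that $(\widetilde u_1,\widetilde u_2)\sim(\widetilde u_1^*,\widetilde u_2^* )$ as $r\to0$ and $$\lim_{r\to\infty}\widetilde u_1=c_1>0,\quad \lim_{r\to\infty}\widetilde u_2=c_2>0,\quad \lim_{r\to\infty}r^{N-1}\widetilde u_1'=k_1>0,\quad \lim_{r\to\infty}r^{(N-1)q-1}\widetilde u_2'=c(k_1)>0;$$ • if $q>\max(q_4,\frac N{N-1})$, there exist solutions such that $(\widetilde u_1,\widetilde u_2)\sim(\widetilde u_1^*,\widetilde u_2^* )$ as $r\to0$ and $$\lim_{r\to\infty}\widetilde u_i=c_i>0\ (i=1,2),\quad \lim_{r\to\infty}r^{N-1}\widetilde u_1'=k_1>0,\quad \lim_{r\to\infty}r^{N-1}\widetilde u_2'=k_2>0 .$$ (ii) The system $-\Delta u_1=|\nabla u_2|^p$,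 $-\Delta u_2=|\nabla u_1|^q$, $u_1,u_2\ge0$, admits bounded solutions in $\mathbb{R}^N\setminus\{0\}$ of the form $(u_1,u_2)=(C_1-\widetilde u_1,C_2-\widetilde u_2)$, where $(\widetilde u_1,\widetilde u_2)$ is a bounded solution as in (i), for $C_1>c_1$, $C_2>c_2$. (iii) The system $-\Delta\widehat u_1=|\nabla\widehat u_2|^p$, $\Delta\widehat u_2=|\nabla\widehat u_1|^q$, $\widehat u_1,\widehat u_2\ge0$, admits bounded solutions in $\mathbb{R}^N\setminus\{0\}$ of the same form, i.e. $(\widehat u_1,-\widehat u_2)=(C_1-\widetilde u_1,C_2-\widetilde u_2)$, for $C_1>c_1$, $C_2<0$.
   Context: $\beta_1=\frac{N+p-(N-1)pq}{pq-1}$, $\beta_2=\frac{N+q-(N-1)pq}{pq-1}$, $a_1=(|\beta_1||\beta_2|^p)^{\frac1{pq-1}}$, $a_2=(|\beta_2||\beta_1|^q)^{\frac1{pq-1}}$, $A_1^*=\left|\frac{a_1(pq-1)}{p(q-1)-2}\right|$, $A_2^*=\left|\frac{a_2(pq-1)}{q(p-1)-2}\right|$. A function $u(r)$ is a cusp-solution if it has a finite limit and $|u'|\to\infty$ as $r\to0$. $(u,v)\sim(f,g)$ means $u/f\to1$ and $v/g\to1$; $c(k_1)$ is a positive constant depending on $k_1$. Here $r=|x|$, $'=d/dr$. *)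

theory Defs
  imports "HOL-Analysis.Analysis"
begin

section \<open>Classical differential operators\<close>

definition grad :: "('a::euclidean_space \<Rightarrow> real) \<Rightarrow> 'a \<Rightarrow> 'a" where
  "grad u x = (THE D. GDERIV u x :> D)"

definition laplacian :: "('a::euclidean_space \<Rightarrow> real) \<Rightarrow> 'a \<Rightarrow> real" where
  "laplacian u x = (\<Sum>b\<in>Basis. deriv (\<lambda>t. grad u (x + t *\<^sub>R b) \<bullet> b) 0)"

text \<open>\<open>H x\<close> is the Hessian at \<open>x\<close>, viewed as a linear map. As the dimension is finite,
  its pointwise continuity in \<open>x\<close> is continuity of all second partial derivatives.\<close>

definition C2_on :: "'a::euclidean_space set \<Rightarrow> ('a \<Rightarrow> real) \<Rightarrow> bool" where
  "C2_on S u \<longleftrightarrow> (\<exists>G H. (\<forall>x\<in>S. (GDERIV u x :> G x) \<and> (G has_derivative H x) (at x)) \<and>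
                        (\<forall>v. continuous_on S (\<lambda>x. H x v)))"

section \<open>The three systems in the punctured space\<close>

definition absorption_solution ::
    "real \<Rightarrow> real \<Rightarrow> ('a::euclidean_space \<Rightarrow> real) \<Rightarrow> ('a \<Rightarrow> real) \<Rightarrow> bool" where
  "absorption_solution p q u1 u2 \<longleftrightarrow>
     C2_on (UNIV - {0}) u1 \<and> C2_on (UNIV - {0}) u2 \<and>
     (\<forall>x. x \<noteq> 0 \<longrightarrow>
        - laplacian u1 x + norm (grad u2 x) powr p = 0 \<and>
        - laplacian u2 x + norm (grad u1 x) powr q = 0 \<and>
        u1 x \<ge> 0 \<and> u2 x \<ge> 0)"

definition source_solution ::
    "real \<Rightarrow> real \<Rightarrow> ('a::euclidean_space \<Rightarrow> real) \<Rightarrow> ('a \<Rightarrow> real) \<Rightarrow> bool" where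
  "source_solution p q u1 u2 \<longleftrightarrow>
     C2_on (UNIV - {0}) u1 \<and> C2_on (UNIV - {0}) u2 \<and>
     (\<forall>x. x \<noteq> 0 \<longrightarrow>
        - laplacian u1 x = norm (grad u2 x) powr p \<and>
        - laplacian u2 x = norm (grad u1 x) powr q \<and>
        u1 x \<ge> 0 \<and> u2 x \<ge> 0)"

definition mixed_solution ::
    "real \<Rightarrow> real \<Rightarrow> ('a::euclidean_space \<Rightarrow> real) \<Rightarrow> ('a \<Rightarrow> real) \<Rightarrow> bool" where
  "mixed_solution p q u1 u2 \<longleftrightarrow>
     C2_on (UNIV - {0}) u1 \<and> C2_on (UNIV - {0}) u2 \<and>
     (\<forall>x. x \<noteq> 0 \<longrightarrow>
        - laplacian u1 x = norm (grad u2 x) powr p \<and>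
        laplacian u2 x = norm (grad u1 x) powr q \<and>
        u1 x \<ge> 0 \<and> u2 x \<ge> 0)"

definition bounded_punctured :: "('a::euclidean_space \<Rightarrow> real) \<Rightarrow> bool" where
  "bounded_punctured u \<longleftrightarrow> bounded (u ` (UNIV - {0}))"

text \<open>A radial function on \<open>real^'n\<close> is given by its profile, a function of \<open>r = norm x\<close>;
  only the values of the profile on \<open>r > 0\<close> matter. The derivative in \<open>r\<close> is \<open>deriv\<close>
  of the profile.\<close>

definition radial :: "(real \<Rightarrow> real) \<Rightarrow> real^'n \<Rightarrow> real" where
  "radial \<phi> x = \<phi> (norm x)"

definition cusp :: "(real \<Rightarrow> real) \<Rightarrow> bool" where
  "cusp \<phi> \<longleftrightarrow> (\<exists>l. (\<phi> \<longlongrightarrow> l) (at_right 0)) \<and>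
               filterlim (\<lambda>r. \<bar>deriv \<phi> r\<bar>) at_top (at_right 0)"

section \<open>Constants and the particular solution\<close>

definition beta1 :: "nat \<Rightarrow> real \<Rightarrow> real \<Rightarrow> real" where
  "beta1 N p q = (real N + p - (real N - 1) * p * q) / (p * q - 1)"

definition beta2 :: "nat \<Rightarrow> real \<Rightarrow> real \<Rightarrow> real" where
  "beta2 N p q = (real N + q - (real N - 1) * p * q) / (p * q - 1)"

definition a1 :: "nat \<Rightarrow> real \<Rightarrow> real \<Rightarrow> real" where
  "a1 N p q = (\<bar>beta1 N p q\<bar> * \<bar>beta2 N p q\<bar> powr p) powr (1 / (p * q - 1))"

definition a2 :: "nat \<Rightarrow> real \<Rightarrow> real \<Rightarrow> real" where
  "a2 N p q = (\<bar>beta2 N p q\<bar> * \<bar>beta1 N p q\<bar> powr q) powr (1 / (p * q - 1))"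

definition A1star :: "nat \<Rightarrow> real \<Rightarrow> real \<Rightarrow> real" where
  "A1star N p q = \<bar>a1 N p q * (p * q - 1) / (p * (q - 1) - 2)\<bar>"

definition A2star :: "nat \<Rightarrow> real \<Rightarrow> real \<Rightarrow> real" where
  "A2star N p q = \<bar>a2 N p q * (p * q - 1) / (q * (p - 1) - 2)\<bar>"

definition u1star :: "nat \<Rightarrow> real \<Rightarrow> real \<Rightarrow> real \<Rightarrow> real" where
  "u1star N p q r = A1star N p q * r powr ((p * (q - 1) - 2) / (p * q - 1))"

definition u2star :: "nat \<Rightarrow> real \<Rightarrow> real \<Rightarrow> real \<Rightarrow> real" where
  "u2star N p q r = A2star N p q * r powr ((q * (p - 1) - 2) / (p * q - 1))"

definition q4 :: "real \<Rightarrow> real" where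
  "q4 p = (p + 2) / p"

section \<open>Asymptotic behaviour of the profiles\<close>

text \<open>The exponent \<open>m\<close> is the decay rate of the derivative of the second component at infinity,
  the only point in which the two ranges of \<open>q\<close> differ.\<close>

definition asymptotics :: "nat \<Rightarrow> real \<Rightarrow> real \<Rightarrow> real \<Rightarrow> (real \<Rightarrow> real) \<Rightarrow> (real \<Rightarrow> real) \<Rightarrow>
    real \<Rightarrow> real \<Rightarrow> real \<Rightarrow> real \<Rightarrow> bool" where
  "asymptotics N p q m \<phi>1 \<phi>2 c1 c2 k1 k2 \<longleftrightarrow>
     ((\<lambda>r. \<phi>1 r / u1star N p q r) \<longlongrightarrow> 1) (at_right 0) \<and>
     ((\<lambda>r. \<phi>2 r / u2star N p q r) \<longlongrightarrow> 1) (at_right 0) \<and>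
     (\<phi>1 \<longlongrightarrow> c1) at_top \<and> c1 > 0 \<and>
     (\<phi>2 \<longlongrightarrow> c2) at_top \<and> c2 > 0 \<and>
     ((\<lambda>r. r powr (real N - 1) * deriv \<phi>1 r) \<longlongrightarrow> k1) at_top \<and> k1 > 0 \<and>
     ((\<lambda>r. r powr m * deriv \<phi>2 r) \<longlongrightarrow> k2) at_top \<and> k2 > 0"

definition rate :: "nat \<Rightarrow> real \<Rightarrow> real" where
  "rate N q = (if q < real N / (real N - 1) then (real N - 1) * q - 1 else real N - 1)"

end

theory Submission
  imports Defs
begin

text \<open>
  For radial functions the absorption system says that the fluxes \<open>W\<^sub>i = r\<^sup>N\<^sup>-\<^sup>1 u\<^sub>i'\<close> satisfy
  \<open>W\<^sub>1' = r\<^sup>N\<^sup>-\<^sup>1 |u\<^sub>2'|\<^sup>p\<close> and \<open>W\<^sub>2' = r\<^sup>N\<^sup>-\<^sup>1 |u\<^sub>1'|\<^sup>q\<close> (\<open>radial_absorption_iff\<close>). This is a first-order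
  system for \<open>(u\<^sub>1', u\<^sub>2')\<close> which is invariant under scaling. Dividing by the particular solution, with
  \<open>u\<^sub>1' = a\<^sub>1 r powr (-\<alpha>\<^sub>1) * x\<close>, \<open>u\<^sub>2' = a\<^sub>2 r powr (-\<alpha>\<^sub>2) * y\<close> and \<open>b\<^sub>i = N - 1 - \<alpha>\<^sub>i = -\<beta>\<^sub>i > 0\<close>,
  turns it into the autonomous planar system
  \<open>r x' = b\<^sub>1 (y\<^sup>p - x)\<close>, \<open>r y' = b\<^sub>2 (x\<^sup>q - y)\<close>,
  in which the particular solution is the equilibrium \<open>(1, 1)\<close>, a saddle because \<open>pq > 1\<close>, and the
  origin is a stable node. The bounded solutions of the theorem are the orbit from \<open>(1, 1)\<close> to
  \<open>(0, 0)\<close>: it makes \<open>u\<^sub>i\<close> asymptotic to the particular solution at the origin, and the approach to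
  \<open>(0, 0)\<close> produces the decay rates at infinity.

  The orbit is found by monotone iteration. Integrating, an orbit that emanates from \<open>(1, 1)\<close> is a fixed
  point of \<open>x = M\<^sub>1(y\<^sup>p)\<close>, \<open>y = M\<^sub>2(x\<^sup>q)\<close>, where \<open>M\<^sub>i g (r)\<close> is the mean of \<open>g\<close> over \<open>(0, r)\<close> with
  weight proportional to \<open>s powr (b\<^sub>i - 1)\<close> (\<open>pow_mean\<close>). These operators are increasing, so a fixed
  point lies between any ordered pair of a sub- and a supersolution (\<open>monotone_iteration\<close>). If \<open>l > 0\<close> is
  the unstable eigenvalue at \<open>(1, 1)\<close> and \<open>(s\<^sub>1, s\<^sub>2)\<close> a suitably scaled eigenvector, then the tangent
  \<open>1 - s\<^sub>i r\<^sup>l\<close>, cut off at \<open>0\<close>, is a subsolution by convexity of powers, and \<open>(1 + r\<^sup>l) powr (-s\<^sub>i)\<close> is a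
  supersolution as long as \<open>s\<^sub>i l \<le> b\<^sub>i\<close>. Both tend to \<open>1\<close> at the origin. When one of the two constraints
  is an equality, the supersolution already decays at the optimal rate in that component
  (\<open>heteroclinic\<close>), and this suffices to bound \<open>W\<^sub>1\<close>.

  At infinity \<open>W\<^sub>1\<close> is nondecreasing and bounded, hence tends to some \<open>k\<^sub>1 > 0\<close>. Thus \<open>W\<^sub>2'\<close> behaves like
  \<open>k\<^sub>1\<^sup>q r powr ((N - 1) * (1 - q))\<close>: it is integrable if \<open>q > N / (N - 1)\<close>, and otherwise l'Hopital's rule
  gives the growth of \<open>W\<^sub>2\<close>. The latter argument applies to every solution for which \<open>W\<^sub>1\<close> has
  a positive limit, so the constant is always \<open>c(k\<^sub>1) = k\<^sub>1\<^sup>q / (N - (N - 1) q)\<close>.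

  For the other two systems only signs have to be checked, that is \<open>u\<^sub>i \<le> c\<^sub>i\<close>. Each flux is nondecreasing; if
  it were negative somewhere, it would stay below a negative constant near the origin and
  \<open>u\<^sub>i\<close> would be unbounded there. So \<open>u\<^sub>i\<close> is nondecreasing and stays below its limit.
\<close>


section \<open>Radial functions and the radial system\<close>

lemma grad_eq:
  assumes "GDERIV u x :> D"
  shows "grad u x = D"
  unfolding grad_def
proof (rule the_equality)
  fix D' assume "GDERIV u x :> D'"
  with assms have "(\<lambda>h. h \<bullet> D') = (\<lambda>h. h \<bullet> D)"
    unfolding gderiv_def by (metis has_derivative_unique)
  then show "D' = D"
    by (metis inner_commute vector_eq_rdot)
qed (fact assms)

text \<open>The Laplacian is defined through directional derivatives of \<open>grad u\<close>, which is itself a definite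
  description; on an open set where a gradient field is known it reduces to the trace of the Hessian.\<close>

lemma laplacian_eq_trace:
  fixes u :: "'a::euclidean_space \<Rightarrow> real"
  assumes "open S" "x \<in> S"
    and G: "\<And>y. y \<in> S \<Longrightarrow> GDERIV u y :> G y"
    and H: "(G has_derivative H) (at x)"
  shows "laplacian u x = (\<Sum>b\<in>Basis. H b \<bullet> b)"
  unfolding laplacian_def
proof (rule sum.cong)
  fix b :: 'a assume "b \<in> Basis"
  let ?line = "\<lambda>t::real. x + t *\<^sub>R b"
  have line: "(?line has_derivative (\<lambda>t. t *\<^sub>R b)) (at 0)"
    by (auto intro!: derivative_eq_intros)
  have "(G \<circ> ?line has_derivative H \<circ> (\<lambda>t. t *\<^sub>R b)) (at 0)"
    by (rule diff_chain_at[OF line]) (use H in simp)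
  then have "((\<lambda>t. G (?line t) \<bullet> b) has_derivative (\<lambda>t. H (t *\<^sub>R b) \<bullet> b)) (at 0)"
    by (auto intro!: derivative_eq_intros simp: o_def)
  moreover have "(\<lambda>t. H (t *\<^sub>R b) \<bullet> b) = (\<lambda>t. (H b \<bullet> b) * t)"
    using has_derivative_linear[OF H] by (auto simp: linear_cmul)
  ultimately have D: "((\<lambda>t. G (?line t) \<bullet> b) has_field_derivative H b \<bullet> b) (at 0)"
    by (simp add: has_field_derivative_def)
  have "open (?line -` S)"
    by (rule open_vimage[OF \<open>open S\<close>]) (intro continuous_intros)
  then have "((\<lambda>t. grad u (?line t) \<bullet> b) has_field_derivative H b \<bullet> b) (at 0)"
    by (rule has_field_derivative_transform_within_open[OF D])
       (use \<open>x \<in> S\<close> grad_eq[OF G] in auto)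
  then show "deriv (\<lambda>t. grad u (?line t) \<bullet> b) 0 = H b \<bullet> b"
    by (rule DERIV_imp_deriv)
qed simp

lemma radial_has_gradient:
  fixes x :: "real^'n"
  assumes "x \<noteq> 0" "(\<phi> has_real_derivative w) (at (norm x))"
  shows "GDERIV (radial \<phi>) x :> (w / norm x) *\<^sub>R x"
proof -
  have "GDERIV (\<lambda>x. \<phi> (norm x)) x :> w *\<^sub>R sgn x"
    using GDERIV_DERIV_compose[OF GDERIV_norm[OF assms(1)] assms(2)] by simp
  then show ?thesis
    by (simp add: radial_def[abs_def] sgn_div_norm divide_inverse)
qed

text \<open>The gradient of a radial function is \<open>w(|x|) x / |x|\<close> with \<open>w\<close> the derivative of the profile. Its
  derivative has the tangential part \<open>w / |x|\<close> times the identity, corrected in the direction of \<open>x\<close>.\<close>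

lemma radial_has_hessian:
  fixes x :: "'a::euclidean_space"
  assumes "x \<noteq> 0" "(w has_real_derivative z) (at (norm x))"
  shows "((\<lambda>x. (w (norm x) / norm x) *\<^sub>R x) has_derivative
           (\<lambda>h. (w (norm x) / norm x) *\<^sub>R h +
                ((z - w (norm x) / norm x) * (x \<bullet> h) / (norm x)\<^sup>2) *\<^sub>R x)) (at x)"
proof -
  have n: "(norm has_derivative (\<lambda>h. h \<bullet> sgn x)) (at x)"
    using GDERIV_norm[OF assms(1)] by (simp add: gderiv_def)
  have "((\<lambda>r. w r / r) has_real_derivative (z - w (norm x) / norm x) / norm x) (at (norm x))"
    by (rule DERIV_cong[OF DERIV_divide[OF assms(2) DERIV_ident]])
       (use assms(1) in \<open>simp_all add: field_simps power2_eq_square\<close>)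
  from diff_chain_at[OF n this[unfolded has_field_derivative_def]]
  have "((\<lambda>x. w (norm x) / norm x) has_derivative
      (\<lambda>h. (z - w (norm x) / norm x) / norm x * (h \<bullet> sgn x))) (at x)"
    by (simp add: o_def)
  moreover have "(\<lambda>h. (z - w (norm x) / norm x) / norm x * (h \<bullet> sgn x))
      = (\<lambda>h. (z - w (norm x) / norm x) * (x \<bullet> h) / (norm x)\<^sup>2)"
    by (simp add: sgn_div_norm inner_commute power2_eq_square divide_inverse mult_ac)
  ultimately have "((\<lambda>x. w (norm x) / norm x) has_derivative
      (\<lambda>h. (z - w (norm x) / norm x) * (x \<bullet> h) / (norm x)\<^sup>2)) (at x)"
    by simp
  from has_derivative_scaleR[OF this has_derivative_ident] show ?thesis .
qed

lemma radial_laplacian: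
  fixes x :: "real^'n"
  assumes "\<And>r. r > 0 \<Longrightarrow> (\<phi> has_real_derivative w r) (at r)"
    and "(w has_real_derivative z) (at (norm x))" and "x \<noteq> 0"
  shows "laplacian (radial \<phi>) x = z + (real CARD('n) - 1) / norm x * w (norm x)"
proof -
  let ?H = "\<lambda>h. (w (norm x) / norm x) *\<^sub>R h +
                ((z - w (norm x) / norm x) * (x \<bullet> h) / (norm x)\<^sup>2) *\<^sub>R x"
  let ?a = "w (norm x) / norm x"
  have "laplacian (radial \<phi>) x = (\<Sum>b\<in>Basis. ?H b \<bullet> b)"
  proof (rule laplacian_eq_trace)
    show "open (UNIV - {0::real^'n})" by auto
    show "GDERIV (radial \<phi>) y :> (w (norm y) / norm y) *\<^sub>R y" if "y \<in> UNIV - {0}" for y :: "real^'n"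
      using that by (intro radial_has_gradient assms(1)) auto
  qed (use assms radial_has_hessian in auto)
  moreover have "(\<Sum>b\<in>Basis. ?H b \<bullet> b) = (\<Sum>b\<in>(Basis::(real^'n) set). ?a * (b \<bullet> b))
      + (z - ?a) / (norm x)\<^sup>2 * (\<Sum>b\<in>Basis. (x \<bullet> b) * (x \<bullet> b))"
    by (simp add: inner_add_left sum.distrib sum_distrib_left mult.assoc)
  moreover have "(\<Sum>b\<in>Basis. (x \<bullet> b) * (x \<bullet> b)) = (norm x)\<^sup>2"
    by (metis euclidean_inner power2_norm_eq_inner)
  moreover have "(\<Sum>b\<in>(Basis::(real^'n) set). ?a * (b \<bullet> b)) = real CARD('n) * ?a"
    by (simp add: inner_Basis)
  moreover have "(z - ?a) / (norm x)\<^sup>2 * (norm x)\<^sup>2 = z - ?a"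
    using assms(3) by simp
  ultimately have "laplacian (radial \<phi>) x = real CARD('n) * ?a + (z - ?a)"
    by simp
  also have "real CARD('n) * a + (z - a) = z + (real CARD('n) - 1) * a" for a :: real
    by (simp add: algebra_simps)
  finally show ?thesis by simp
qed

lemma radial_C2:
  fixes \<phi> :: "real \<Rightarrow> real"
  assumes "\<And>r. r > 0 \<Longrightarrow> (\<phi> has_real_derivative w r) (at r)"
    and "\<And>r. r > 0 \<Longrightarrow> (w has_real_derivative z r) (at r)"
    and "continuous_on {0<..} z"
  shows "C2_on (UNIV - {0}) (radial \<phi> :: real^'n \<Rightarrow> real)"
  unfolding C2_on_def
proof (intro exI conjI ballI allI)
  fix x :: "real^'n" assume "x \<in> UNIV - {0}"
  then show "GDERIV (radial \<phi>) x :> (w (norm x) / norm x) *\<^sub>R x"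
    "((\<lambda>x. (w (norm x) / norm x) *\<^sub>R x) has_derivative
        (\<lambda>h. (w (norm x) / norm x) *\<^sub>R h +
          ((z (norm x) - w (norm x) / norm x) * (x \<bullet> h) / (norm x)\<^sup>2) *\<^sub>R x)) (at x)"
    by (auto intro!: radial_has_gradient radial_has_hessian assms)
next
  fix v :: "real^'n"
  have "continuous_on {0<..} w"
    using assms(2) by (meson DERIV_isCont continuous_at_imp_continuous_on greaterThan_iff)
  then have *: "continuous_on (UNIV - {0}) (\<lambda>x::real^'n. w (norm x))"
    by (rule continuous_on_compose2) (auto intro!: continuous_intros)
  have "continuous_on (UNIV - {0}) (\<lambda>x::real^'n. z (norm x))"
    by (rule continuous_on_compose2[OF assms(3)]) (auto intro!: continuous_intros)
  with * show "continuous_on (UNIV - {0}) (\<lambda>x::real^'n. (w (norm x) / norm x) *\<^sub>R v +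
          ((z (norm x) - w (norm x) / norm x) * (x \<bullet> v) / (norm x)\<^sup>2) *\<^sub>R x)"
    by (auto intro!: continuous_intros)
qed

text \<open>Restricting to a ray recovers the differentiability of the profile.\<close>

lemma profile_of_radial_C2:
  assumes "C2_on (UNIV - {0}) (radial \<phi> :: real^'n \<Rightarrow> real)"
  obtains w z where "\<And>r. r > 0 \<Longrightarrow> (\<phi> has_real_derivative w r) (at r)"
    and "\<And>r. r > 0 \<Longrightarrow> (w has_real_derivative z r) (at r)"
proof -
  obtain G H where G: "\<And>x::real^'n. x \<noteq> 0 \<Longrightarrow> GDERIV (radial \<phi>) x :> G x"
    and H: "\<And>x. x \<noteq> 0 \<Longrightarrow> (G has_derivative H x) (at x)"
    using assms by (auto simp: C2_on_def)
  obtain e :: "real^'n" where "e \<in> Basis" by (meson nonempty_Basis ex_in_conv)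
  then have e: "norm e = 1" "e \<noteq> 0" by auto
  have line: "((\<lambda>r. r *\<^sub>R e) has_derivative (\<lambda>r. r *\<^sub>R e)) (at r)" for r
    by (auto intro!: derivative_eq_intros)
  have 1: "(\<phi> has_real_derivative e \<bullet> G (r *\<^sub>R e)) (at r)" if "r > 0" for r
  proof -
    have "((\<lambda>r. radial \<phi> (r *\<^sub>R e)) has_derivative (\<lambda>h. (h *\<^sub>R e) \<bullet> G (r *\<^sub>R e))) (at r)"
      using diff_chain_at[OF line G[of "r *\<^sub>R e", unfolded gderiv_def]] that e by (simp add: o_def)
    then have D: "((\<lambda>r. radial \<phi> (r *\<^sub>R e)) has_real_derivative e \<bullet> G (r *\<^sub>R e)) (at r)"
      by (simp add: has_field_derivative_def mult.commute[of _ "e \<bullet> G (r *\<^sub>R e)"])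
    show ?thesis
      by (rule has_field_derivative_transform_within_open[OF D open_greaterThan[of 0]])
         (use that e in \<open>auto simp: radial_def\<close>)
  qed
  have 2: "((\<lambda>r. e \<bullet> G (r *\<^sub>R e)) has_real_derivative e \<bullet> H (r *\<^sub>R e) e) (at r)" if "r > 0" for r
  proof -
    have "((\<lambda>r. G (r *\<^sub>R e)) has_derivative (\<lambda>h. H (r *\<^sub>R e) (h *\<^sub>R e))) (at r)"
      using diff_chain_at[OF line H[of "r *\<^sub>R e"]] that e by (simp add: o_def)
    then have "((\<lambda>r. e \<bullet> G (r *\<^sub>R e)) has_derivative (\<lambda>h. e \<bullet> H (r *\<^sub>R e) (h *\<^sub>R e))) (at r)"
      by (rule has_derivative_inner_right)
    moreover have "(\<lambda>h. e \<bullet> H (r *\<^sub>R e) (h *\<^sub>R e)) = (\<lambda>h. (e \<bullet> H (r *\<^sub>R e) e) * h)"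
      using has_derivative_linear[OF H[of "r *\<^sub>R e"]] that e by (auto simp: linear_cmul)
    ultimately show ?thesis by (simp add: has_field_derivative_def)
  qed
  from that[OF 1 2] show thesis .
qed

text \<open>Here \<open>\<nu>\<close> stands for \<open>N - 1\<close>. Keeping the fluxes \<open>r powr \<nu> * w\<close> under one derivative, rather than
  writing \<open>w' + \<nu> w / r\<close>, makes their monotonicity visible and lets them be integrated directly.\<close>

definition radial_system ::
    "real \<Rightarrow> real \<Rightarrow> real \<Rightarrow> (real \<Rightarrow> real) \<Rightarrow> (real \<Rightarrow> real) \<Rightarrow> (real \<Rightarrow> real) \<Rightarrow> (real \<Rightarrow> real) \<Rightarrow> bool"
  where
  "radial_system \<nu> p q \<phi>1 \<phi>2 w1 w2 \<longleftrightarrow>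
     (\<forall>r>0. (\<phi>1 has_real_derivative w1 r) (at r) \<and> (\<phi>2 has_real_derivative w2 r) (at r) \<and>
        ((\<lambda>r. r powr \<nu> * w1 r) has_real_derivative r powr \<nu> * \<bar>w2 r\<bar> powr p) (at r) \<and>
        ((\<lambda>r. r powr \<nu> * w2 r) has_real_derivative r powr \<nu> * \<bar>w1 r\<bar> powr q) (at r))"

lemma flux_derivative_iff:
  fixes w :: "real \<Rightarrow> real"
  assumes "r > 0"
  shows "((\<lambda>r. r powr \<nu> * w r) has_real_derivative r powr \<nu> * f) (at r) \<longleftrightarrow>
         (w has_real_derivative f - \<nu> / r * w r) (at r)" (is "?L \<longleftrightarrow> ?R")
proof
  assume w: ?R
  have "((\<lambda>r. r powr \<nu>) has_real_derivative \<nu> * r powr (\<nu> - 1)) (at r)"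
    by (rule has_real_derivative_powr[OF assms])
  from DERIV_mult[OF this w] show ?L
    by (rule DERIV_cong) (use assms in \<open>simp add: algebra_simps powr_diff\<close>)
next
  assume W: ?L
  have "((\<lambda>r. r powr (-\<nu>)) has_real_derivative -\<nu> * r powr (-\<nu> - 1)) (at r)"
    by (rule has_real_derivative_powr[OF assms])
  from DERIV_mult[OF this W]
  have D: "((\<lambda>r. r powr (-\<nu>) * (r powr \<nu> * w r)) has_real_derivative f - \<nu> / r * w r) (at r)"
    by (rule DERIV_cong) (use assms in \<open>simp add: powr_diff powr_minus field_simps\<close>)
  show ?R
    by (rule has_field_derivative_transform_within_open[OF D open_greaterThan[of 0]])
       (use assms in \<open>auto simp: powr_minus field_simps\<close>)
qed

theorem radial_absorption_iff:
  fixes p q :: real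
  assumes "p > 0" "q > 0"
  shows "absorption_solution p q (radial \<phi>1 :: real^'n \<Rightarrow> real) (radial \<phi>2) \<longleftrightarrow>
     (\<exists>w1 w2. radial_system (real CARD('n) - 1) p q \<phi>1 \<phi>2 w1 w2) \<and>
     (\<forall>r>0. \<phi>1 r \<ge> 0 \<and> \<phi>2 r \<ge> 0)"
    (is "?A \<longleftrightarrow> (\<exists>w1 w2. ?S w1 w2) \<and> ?P")
proof
  let ?\<nu> = "real CARD('n) - 1"
  assume ?A
  then have C1: "C2_on (UNIV - {0}) (radial \<phi>1 :: real^'n \<Rightarrow> real)"
    and C2: "C2_on (UNIV - {0}) (radial \<phi>2 :: real^'n \<Rightarrow> real)"
    and eq: "\<And>x::real^'n. x \<noteq> 0 \<Longrightarrow> laplacian (radial \<phi>1) x = norm (grad (radial \<phi>2) x) powr p \<and>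
      laplacian (radial \<phi>2) x = norm (grad (radial \<phi>1) x) powr q \<and>
        radial \<phi>1 x \<ge> 0 \<and> radial \<phi>2 x \<ge> 0"
    by (auto simp: absorption_solution_def)
  obtain w1 z1 where w1: "\<And>r. r > 0 \<Longrightarrow> (\<phi>1 has_real_derivative w1 r) (at r)"
    and z1: "\<And>r. r > 0 \<Longrightarrow> (w1 has_real_derivative z1 r) (at r)"
    using profile_of_radial_C2[OF C1] by metis
  obtain w2 z2 where w2: "\<And>r. r > 0 \<Longrightarrow> (\<phi>2 has_real_derivative w2 r) (at r)"
    and z2: "\<And>r. r > 0 \<Longrightarrow> (w2 has_real_derivative z2 r) (at r)"
    using profile_of_radial_C2[OF C2] by metis
  obtain e :: "real^'n" where "e \<in> Basis" by (meson nonempty_Basis ex_in_conv)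
  then have e: "norm e = 1" "e \<noteq> 0" by auto
  have sys: "z1 r + ?\<nu> / r * w1 r = \<bar>w2 r\<bar> powr p \<and> z2 r + ?\<nu> / r * w2 r = \<bar>w1 r\<bar> powr q
      \<and> \<phi>1 r \<ge> 0 \<and> \<phi>2 r \<ge> 0" if "r > 0" for r
  proof -
    define x where "x = r *\<^sub>R e"
    have x: "x \<noteq> 0" "norm x = r" using that e by (auto simp: x_def)
    have "grad (radial \<phi>1) x = (w1 r / r) *\<^sub>R x" "grad (radial \<phi>2) x = (w2 r / r) *\<^sub>R x"
      using radial_has_gradient[OF x(1)] x w1 w2 that by (auto intro!: grad_eq)
    then show ?thesis
      using eq[OF x(1)] radial_laplacian[OF w1 z1[of "norm x"] x(1)] radial_laplacian[OF w2 z2[of "norm x"] x(1)]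
        x that by (simp add: radial_def)
  qed
  have "?S w1 w2"
    unfolding radial_system_def
  proof (intro allI impI conjI w1 w2)
    fix r :: real assume r: "r > 0"
    have "\<bar>w2 r\<bar> powr p - ?\<nu> / r * w1 r = z1 r" "\<bar>w1 r\<bar> powr q - ?\<nu> / r * w2 r = z2 r"
      using sys[OF r] by linarith+
    then show "((\<lambda>r. r powr ?\<nu> * w1 r) has_real_derivative r powr ?\<nu> * \<bar>w2 r\<bar> powr p) (at r)"
      "((\<lambda>r. r powr ?\<nu> * w2 r) has_real_derivative r powr ?\<nu> * \<bar>w1 r\<bar> powr q) (at r)"
      unfolding flux_derivative_iff[OF r] using z1[OF r] z2[OF r] by simp_all
  qed
  then show "(\<exists>w1 w2. ?S w1 w2) \<and> ?P" using sys by blast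
next
  let ?\<nu> = "real CARD('n) - 1"
  assume "(\<exists>w1 w2. ?S w1 w2) \<and> ?P"
  then obtain w1 w2 where S: "?S w1 w2" and P: ?P by blast
  define z1 where "z1 r = \<bar>w2 r\<bar> powr p - ?\<nu> / r * w1 r" for r
  define z2 where "z2 r = \<bar>w1 r\<bar> powr q - ?\<nu> / r * w2 r" for r
  have w1: "(\<phi>1 has_real_derivative w1 r) (at r)" and w2: "(\<phi>2 has_real_derivative w2 r) (at r)"
    and z1: "(w1 has_real_derivative z1 r) (at r)" and z2: "(w2 has_real_derivative z2 r) (at r)"
    if "r > 0" for r
    using S that by (auto simp: radial_system_def flux_derivative_iff z1_def z2_def)
  have "continuous_on {0<..} w1" "continuous_on {0<..} w2"
    using z1 z2 by (meson DERIV_isCont continuous_at_imp_continuous_on greaterThan_iff)+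
  then have "continuous_on {0<..} z1" "continuous_on {0<..} z2"
    unfolding z1_def z2_def using assms
    by (auto intro!: continuous_intros continuous_on_powr')
  then have "C2_on (UNIV - {0}) (radial \<phi>1 :: real^'n \<Rightarrow> real)"
    "C2_on (UNIV - {0}) (radial \<phi>2 :: real^'n \<Rightarrow> real)"
    by (auto intro: radial_C2 w1 w2 z1 z2)
  moreover have "- laplacian (radial \<phi>1) x + norm (grad (radial \<phi>2) x) powr p = 0 \<and>
        - laplacian (radial \<phi>2) x + norm (grad (radial \<phi>1) x) powr q = 0 \<and>
        radial \<phi>1 x \<ge> 0 \<and> radial \<phi>2 x \<ge> 0" if "x \<noteq> 0" for x :: "real^'n"
  proof -
    have "norm (grad (radial \<phi>1) x) = \<bar>w1 (norm x)\<bar>" "norm (grad (radial \<phi>2) x) = \<bar>w2 (norm x)\<bar>"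
      using grad_eq[OF radial_has_gradient[OF that w1]] grad_eq[OF radial_has_gradient[OF that w2]]
        that by auto
    then show ?thesis
      using radial_laplacian[OF w1 z1[of "norm x"] that] radial_laplacian[OF w2 z2[of "norm x"] that] P that
      by (simp add: z1_def z2_def radial_def)
  qed
  ultimately show ?A by (simp add: absorption_solution_def)
qed

section \<open>Power means and monotone iteration\<close>

text \<open>The substitution \<open>\<rho> = s powr b\<close> in \<open>b r powr (-b) * \<integral>\<^sub>0\<^sup>r s powr (b - 1) * g s ds\<close>: for \<open>b < 1\<close> the weight
  is singular at \<open>0\<close>, while the integrand below is continuous whenever \<open>g\<close> is. The value at \<open>r = 0\<close>
  makes the mean continuous there. It is the solution of \<open>r f' = b (g - f)\<close> that is regular at \<open>0\<close>.\<close>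

definition pow_mean :: "real \<Rightarrow> (real \<Rightarrow> real) \<Rightarrow> real \<Rightarrow> real" where
  "pow_mean b g r =
     (if r = 0 then g 0 else integral {0..r powr b} (\<lambda>\<rho>. g (\<rho> powr (1 / b))) / r powr b)"

lemma continuous_on_powr_nonneg:
  assumes "continuous_on {0..} g" "a > 0" "\<And>r. r \<ge> 0 \<Longrightarrow> g r \<ge> (0::real)"
  shows "continuous_on {0..} (\<lambda>r::real. g r powr a)"
  by (rule continuous_on_powr'[OF assms(1) continuous_on_const]) (use assms in auto)

lemma pow_mean_integrand_continuous:
  fixes g :: "real \<Rightarrow> real"
  assumes "b > 0" "continuous_on {0..} g"
  shows "continuous_on {0..R::real} (\<lambda>\<rho>. g (\<rho> powr (1 / b)))"
proof (rule continuous_on_compose2[OF assms(2)])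
  show "continuous_on {0..R::real} (\<lambda>\<rho>. \<rho> powr (1 / b))"
    using assms(1) by (intro continuous_on_powr' continuous_intros) auto
qed auto

lemma pow_mean_integrable:
  fixes g :: "real \<Rightarrow> real"
  assumes "b > 0" "continuous_on {0..} g"
  shows "(\<lambda>\<rho>. g (\<rho> powr (1 / b))) integrable_on {0..R::real}"
  by (rule integrable_continuous_real[OF pow_mean_integrand_continuous[OF assms]])

lemma pow_mean_const:
  assumes "r \<ge> 0"
  shows "pow_mean b (\<lambda>_. c) r = c"
  using assms by (simp add: pow_mean_def)

lemma pow_mean_uminus: "pow_mean b (\<lambda>r. - g r) r = - pow_mean b g r"
  by (simp add: pow_mean_def)

lemma pow_mean_mono:
  fixes f g :: "real \<Rightarrow> real"
  assumes "r \<ge> 0" "\<And>s. s \<ge> 0 \<Longrightarrow> f s \<le> g s"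
    and "\<And>R. (\<lambda>\<rho>. f (\<rho> powr (1 / b))) integrable_on {0..R::real}"
    and "\<And>R. (\<lambda>\<rho>. g (\<rho> powr (1 / b))) integrable_on {0..R::real}"
  shows "pow_mean b f r \<le> pow_mean b g r"
proof (cases "r = 0")
  case False
  have "integral {0..r powr b} (\<lambda>\<rho>. f (\<rho> powr (1 / b))) \<le> integral {0..r powr b} (\<lambda>\<rho>. g (\<rho> powr (1 / b)))"
    by (rule integral_le[OF assms(3,4)]) (simp add: assms(2))
  then show ?thesis using False by (simp add: pow_mean_def divide_right_mono)
qed (use assms in \<open>simp add: pow_mean_def\<close>)

lemma pow_mean_continuous_pos:
  assumes b: "b > 0" and "\<And>R. (\<lambda>\<rho>. g (\<rho> powr (1 / b))) integrable_on {0..R::real}"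
  shows "continuous_on {0<..} (pow_mean b g)"
proof -
  let ?I = "\<lambda>R. integral {0..R} (\<lambda>\<rho>. g (\<rho> powr (1 / b)))"
  have I: "isCont ?I R" if "R > 0" for R
  proof -
    have "continuous_on {0..R + 1} ?I"
      by (rule indefinite_integral_continuous_1) (rule assms)
    then show ?thesis
      by (rule continuous_on_interior) (use that in simp)
  qed
  have "isCont (\<lambda>r. ?I (r powr b) / r powr b) r" if "r > 0" for r
  proof -
    have P: "isCont (\<lambda>r. r powr b) r"
      using that by (intro continuous_intros) auto
    have "isCont (\<lambda>r. ?I (r powr b)) r"
      by (rule isCont_o2[OF P I]) (use that in simp)
    then show ?thesis using P that by (intro continuous_divide) auto
  qed
  then have "continuous_on {0<..} (\<lambda>r. ?I (r powr b) / r powr b)"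
    by (simp add: continuous_at_imp_continuous_on)
  then show ?thesis
    by (rule continuous_on_eq) (simp add: pow_mean_def)
qed

lemma pow_mean_has_derivative:
  assumes b: "b > 0" and g: "continuous_on {0..} g" and r: "r > 0"
  shows "((\<lambda>r. r powr b * pow_mean b g r) has_real_derivative b * r powr (b - 1) * g r) (at r)"
proof -
  let ?h = "\<lambda>\<rho>. g (\<rho> powr (1 / b))"
  let ?I = "\<lambda>R. integral {0..R} ?h"
  have "(?I has_real_derivative ?h (r powr b)) (at (r powr b) within {0..r powr b + 1})"
    by (rule integral_has_real_derivative[OF pow_mean_integrand_continuous[OF b g]]) auto
  then have I: "(?I has_real_derivative g r) (at (r powr b))"
    using r b at_within_Icc_at[of 0 "r powr b" "r powr b + 1"] by (simp add: powr_powr)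
  have D: "((\<lambda>r. ?I (r powr b)) has_real_derivative b * r powr (b - 1) * g r) (at r)"
    by (rule DERIV_cong[OF DERIV_chain2[OF I has_real_derivative_powr[OF r]]]) simp
  show ?thesis
    by (rule has_field_derivative_transform_within_open[OF D open_greaterThan[of 0]])
       (use r in \<open>auto simp: pow_mean_def\<close>)
qed

lemma continuous_on_halflineI:
  fixes f :: "real \<Rightarrow> real"
  assumes "continuous_on {0<..} f" "(f \<longlongrightarrow> f 0) (at_right 0)"
  shows "continuous_on {0..} f"
proof -
  have "(f \<longlongrightarrow> f r) (at r within {0..})" if "r \<ge> 0" for r
  proof (cases "r = 0")
    case True
    then show ?thesis using assms(2) by (simp add: at_within_Ici_at_right)
  next
    case False
    with that have "r \<in> {0<..}" by simp
    then have "isCont f r"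
      using assms(1) continuous_on_eq_continuous_at[OF open_greaterThan] by blast
    then show ?thesis
      unfolding isCont_def by (rule tendsto_within_subset) simp
  qed
  then show ?thesis by (simp add: continuous_on_def)
qed

lemma powr_at_right_0:
  assumes "b > (0::real)"
  shows "filterlim (\<lambda>r. r powr b) (at_right 0) (at_right 0)"
proof -
  have "((\<lambda>r. r powr b) \<longlongrightarrow> 0 powr b) (at_right 0)"
    using assms
    by (intro tendsto_powr' tendsto_const tendsto_ident_at)
       (auto intro: eventually_mono[OF eventually_at_right_less[of 0]])
  then show ?thesis
    by (auto simp: filterlim_at intro: eventually_mono[OF eventually_at_right_less[of 0]])
qed

lemma pow_mean_continuous:
  assumes b: "b > 0" and g: "continuous_on {0..} g"
  shows "continuous_on {0..} (pow_mean b g)"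
proof (rule continuous_on_halflineI)
  let ?h = "\<lambda>\<rho>. g (\<rho> powr (1 / b))"
  let ?I = "\<lambda>R. integral {0..R} ?h"
  show "continuous_on {0<..} (pow_mean b g)"
    by (intro pow_mean_continuous_pos pow_mean_integrable b g)
  have "(?I has_real_derivative ?h 0) (at 0 within {0..1})"
    by (rule integral_has_real_derivative[OF pow_mean_integrand_continuous[OF b g]]) auto
  then have "((\<lambda>R. ?I R / R) \<longlongrightarrow> g 0) (at_right 0)"
    using at_within_Icc_at_right[of 0 "1::real"] by (simp add: has_field_derivative_iff)
  then have "((\<lambda>r. ?I (r powr b) / r powr b) \<longlongrightarrow> g 0) (at_right 0)"
    by (rule filterlim_compose[OF _ powr_at_right_0[OF b]])
  then have "(pow_mean b g \<longlongrightarrow> g 0) (at_right 0)"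
  proof (rule Lim_transform_eventually)
    show "\<forall>\<^sub>F r in at_right 0. ?I (r powr b) / r powr b = pow_mean b g r"
      by (rule eventually_mono[OF eventually_at_right_less[of 0]]) (simp add: pow_mean_def)
  qed
  then show "(pow_mean b g \<longlongrightarrow> pow_mean b g 0) (at_right 0)"
    by (simp add: pow_mean_def)
qed

text \<open>Comparison for \<open>r f' = b (g - f)\<close>: multiplied by \<open>r powr b\<close>, the difference of the two sides of the
  conclusion vanishes at \<open>0\<close> and has a nonnegative derivative.\<close>

lemma pow_mean_lower:
  assumes b: "b > 0" and g: "continuous_on {0..} g" and f: "continuous_on {0..} f"
    and D: "\<And>r. r > 0 \<Longrightarrow> (f has_real_derivative f' r) (at r)"
    and le: "\<And>r. r > 0 \<Longrightarrow> f r + r / b * f' r \<le> g r" and "f 0 \<le> g 0" and "r \<ge> 0"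
  shows "f r \<le> pow_mean b g r"
proof (cases "r = 0")
  case True
  then show ?thesis using \<open>f 0 \<le> g 0\<close> by (simp add: pow_mean_def)
next
  case False
  with \<open>r \<ge> 0\<close> have "r > 0" by simp
  let ?F = "\<lambda>r. r powr b * pow_mean b g r - r powr b * f r"
  have "?F 0 \<le> ?F r"
  proof (rule DERIV_nonneg_imp_increasing_open[where f = ?F])
    have "continuous_on {0..r} (\<lambda>r. r powr b)"
      using b by (intro continuous_on_powr' continuous_intros) auto
    moreover have "continuous_on {0..r} (pow_mean b g)" "continuous_on {0..r} f"
      by (auto intro: continuous_on_subset[OF pow_mean_continuous[OF b g]] continuous_on_subset[OF f])
    ultimately show "continuous_on {0..r} ?F"
      by (intro continuous_on_diff continuous_on_mult)
  next
    fix s :: real assume s: "0 < s" "s < r"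
    note s = s(1)
    have "(?F has_real_derivative b * s powr (b - 1) * g s -
        (b * s powr (b - 1) * f s + f' s * s powr b)) (at s)"
      by (intro DERIV_diff pow_mean_has_derivative[OF b g s]
          DERIV_mult[OF has_real_derivative_powr[OF s] D[OF s]])
    moreover have "b * s powr (b - 1) * g s - (b * s powr (b - 1) * f s + f' s * s powr b)
        = b * s powr (b - 1) * (g s - (f s + s / b * f' s))"
    proof -
      have "s powr b = s powr (b - 1) * s"
        using s by (simp add: powr_diff)
      then show ?thesis using b by (simp add: field_simps)
    qed
    ultimately have "(?F has_real_derivative b * s powr (b - 1) * (g s - (f s + s / b * f' s))) (at s)"
      by simp
    moreover have "0 \<le> b * s powr (b - 1) * (g s - (f s + s / b * f' s))"
      using le[OF s] b by simp
    ultimately show "\<exists>y. (?F has_real_derivative y) (at s) \<and> 0 \<le> y" by (intro exI conjI)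
  qed (use \<open>r \<ge> 0\<close> in simp)
  then show ?thesis using \<open>r > 0\<close> b by simp
qed

lemma pow_mean_upper:
  assumes b: "b > 0" and g: "continuous_on {0..} g" and f: "continuous_on {0..} f"
    and D: "\<And>r. r > 0 \<Longrightarrow> (f has_real_derivative f' r) (at r)"
    and le: "\<And>r. r > 0 \<Longrightarrow> g r \<le> f r + r / b * f' r" and "g 0 \<le> f 0" and "r \<ge> 0"
  shows "pow_mean b g r \<le> f r"
proof -
  have "- f r \<le> pow_mean b (\<lambda>r. - g r) r"
  proof (rule pow_mean_lower[OF b])
    show "((\<lambda>r. - f r) has_real_derivative - f' s) (at s)" if "s > 0" for s
      by (rule DERIV_minus[OF D[OF that]])
    show "- f s + s / b * - f' s \<le> - g s" if "s > 0" for s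
      using le[OF that] by simp
    show "- f 0 \<le> - g 0" "r \<ge> 0" using \<open>g 0 \<le> f 0\<close> \<open>r \<ge> 0\<close> by simp_all
  qed (intro continuous_on_minus f g)+
  then show ?thesis unfolding pow_mean_uminus by simp
qed

primrec picard where
  "picard b1 b2 p q x0 y0 0 = (x0, y0)"
| "picard b1 b2 p q x0 y0 (Suc n) =
     (pow_mean b1 (\<lambda>r. snd (picard b1 b2 p q x0 y0 n) r powr p),
      pow_mean b2 (\<lambda>r. fst (picard b1 b2 p q x0 y0 n) r powr q))"

lemma pow_mean_mono_powr:
  assumes "b > 0" "a > 0" "continuous_on {0..} f" "continuous_on {0..} g"
    and "\<And>s. s \<ge> 0 \<Longrightarrow> 0 \<le> f s \<and> f s \<le> g s" and "r \<ge> 0"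
  shows "pow_mean b (\<lambda>r. f r powr a) r \<le> pow_mean b (\<lambda>r. g r powr a) r"
proof (rule pow_mean_mono[OF \<open>r \<ge> 0\<close>])
  have f: "0 \<le> f s" and g: "0 \<le> g s" if "s \<ge> 0" for s
    using assms(5)[OF that] by linarith+
  show "f s powr a \<le> g s powr a" if "s \<ge> 0" for s
    using assms(2,5) that by (simp add: powr_mono2)
  show "(\<lambda>\<rho>. f (\<rho> powr (1 / b)) powr a) integrable_on {0..R}" for R
    by (rule pow_mean_integrable[OF assms(1) continuous_on_powr_nonneg[OF assms(3,2) f]])
  show "(\<lambda>\<rho>. g (\<rho> powr (1 / b)) powr a) integrable_on {0..R}" for R
    by (rule pow_mean_integrable[OF assms(1) continuous_on_powr_nonneg[OF assms(4,2) g]])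
qed

lemma pow_mean_monotone_limit:
  assumes b: "b > 0" and a: "a > 0"
    and f: "\<And>n. continuous_on {0..} (f n)" "\<And>n r. r \<ge> 0 \<Longrightarrow> 0 \<le> f n r"
      "\<And>n r. r \<ge> 0 \<Longrightarrow> f n r \<le> f (Suc n) r"
    and u: "continuous_on {0..} u" "\<And>n r. r \<ge> 0 \<Longrightarrow> f n r \<le> u r"
    and lim: "\<And>r. r \<ge> 0 \<Longrightarrow> (\<lambda>n. f n r) \<longlonglongrightarrow> g r"
  shows "(\<lambda>\<rho>. g (\<rho> powr (1 / b)) powr a) integrable_on {0..R::real}"
    and "r \<ge> 0 \<Longrightarrow> (\<lambda>n. pow_mean b (\<lambda>r. f n r powr a) r) \<longlonglongrightarrow> pow_mean b (\<lambda>r. g r powr a) r"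
proof -
  have lim': "(\<lambda>n. f n r powr a) \<longlonglongrightarrow> g r powr a" if "r \<ge> 0" for r
    by (rule tendsto_powr'[OF lim tendsto_const]) (use a f that in auto)
  have "0 \<le> u r" if "r \<ge> 0" for r
    using f(2)[OF that] u(2)[OF that] by (meson order_trans)
  then have int: "(\<lambda>\<rho>. f n (\<rho> powr (1 / b)) powr a) integrable_on {0..R::real}"
    "(\<lambda>\<rho>. u (\<rho> powr (1 / b)) powr a) integrable_on {0..R::real}" for n R
    using pow_mean_integrable[OF b continuous_on_powr_nonneg[OF f(1) a f(2)]]
      pow_mean_integrable[OF b continuous_on_powr_nonneg[OF u(1) a]] by auto
  have *: "(\<lambda>\<rho>. g (\<rho> powr (1 / b)) powr a) integrable_on {0..R} \<and>
      (\<lambda>n. integral {0..R} (\<lambda>\<rho>. f n (\<rho> powr (1 / b)) powr a)) \<longlonglongrightarrow>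
        integral {0..R} (\<lambda>\<rho>. g (\<rho> powr (1 / b)) powr a)" for R
  proof (rule monotone_convergence_increasing)
    have "\<bar>integral {0..R} (\<lambda>\<rho>. f n (\<rho> powr (1 / b)) powr a)\<bar>
        \<le> integral {0..R} (\<lambda>\<rho>. u (\<rho> powr (1 / b)) powr a)" for n
    proof -
      have "0 \<le> integral {0..R} (\<lambda>\<rho>. f n (\<rho> powr (1 / b)) powr a)"
        by (rule integral_nonneg[OF int(1)]) simp
      moreover have "integral {0..R} (\<lambda>\<rho>. f n (\<rho> powr (1 / b)) powr a)
          \<le> integral {0..R} (\<lambda>\<rho>. u (\<rho> powr (1 / b)) powr a)"
        using a f(2) u(2) by (intro integral_le int powr_mono2) auto
      ultimately show ?thesis by simp
    qed
    then show "bounded (range (\<lambda>n. integral {0..R} (\<lambda>\<rho>. f n (\<rho> powr (1 / b)) powr a)))"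
      by (auto simp: bounded_iff)
  qed (use a f lim' int in \<open>auto intro!: powr_mono2\<close>)
  then show "(\<lambda>\<rho>. g (\<rho> powr (1 / b)) powr a) integrable_on {0..R::real}" by blast
  show "(\<lambda>n. pow_mean b (\<lambda>r. f n r powr a) r) \<longlonglongrightarrow> pow_mean b (\<lambda>r. g r powr a) r" if "r \<ge> 0"
  proof (cases "r = 0")
    case True
    then show ?thesis using lim' by (simp add: pow_mean_def)
  next
    case False
    then show ?thesis using *[of "r powr b"]
      by (auto simp: pow_mean_def intro!: tendsto_divide tendsto_const)
  qed
qed

text \<open>The iterates that start from the subsolution increase and stay below the supersolution, so they converge,
  and the monotone convergence theorem passes to the limit in the integrals. Means of integrable functions are
  continuous away from \<open>0\<close>; at \<open>0\<close> the limit is squeezed between the two barriers, which agree there.\<close>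

theorem monotone_iteration:
  fixes xl yl xu yu :: "real \<Rightarrow> real"
  assumes pos: "b1 > 0" "b2 > 0" "p > 0" "q > 0"
    and cont: "continuous_on {0..} xl" "continuous_on {0..} yl"
      "continuous_on {0..} xu" "continuous_on {0..} yu"
    and ord: "\<And>r. r \<ge> 0 \<Longrightarrow> 0 \<le> xl r \<and> xl r \<le> xu r" "\<And>r. r \<ge> 0 \<Longrightarrow> 0 \<le> yl r \<and> yl r \<le> yu r"
    and sub: "\<And>r. r \<ge> 0 \<Longrightarrow> xl r \<le> pow_mean b1 (\<lambda>r. yl r powr p) r"
      "\<And>r. r \<ge> 0 \<Longrightarrow> yl r \<le> pow_mean b2 (\<lambda>r. xl r powr q) r"
    and super: "\<And>r. r \<ge> 0 \<Longrightarrow> pow_mean b1 (\<lambda>r. yu r powr p) r \<le> xu r"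
      "\<And>r. r \<ge> 0 \<Longrightarrow> pow_mean b2 (\<lambda>r. xu r powr q) r \<le> yu r"
    and touch: "xl 0 = xu 0" "yl 0 = yu 0"
  obtains x y where "continuous_on {0..} x" "continuous_on {0..} y"
    and "\<And>r. r \<ge> 0 \<Longrightarrow> xl r \<le> x r \<and> x r \<le> xu r" "\<And>r. r \<ge> 0 \<Longrightarrow> yl r \<le> y r \<and> y r \<le> yu r"
    and "\<And>r. r \<ge> 0 \<Longrightarrow> x r = pow_mean b1 (\<lambda>r. y r powr p) r"
    and "\<And>r. r \<ge> 0 \<Longrightarrow> y r = pow_mean b2 (\<lambda>r. x r powr q) r"
proof -
  define xs where "xs n = fst (picard b1 b2 p q xl yl n)" for n
  define ys where "ys n = snd (picard b1 b2 p q xl yl n)" for n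
  have step: "xs (Suc n) = pow_mean b1 (\<lambda>r. ys n r powr p)"
    "ys (Suc n) = pow_mean b2 (\<lambda>r. xs n r powr q)" for n
    by (simp_all add: xs_def ys_def)
  have start: "xs 0 = xl" "ys 0 = yl" by (simp_all add: xs_def ys_def)
  have inv: "continuous_on {0..} (xs n) \<and> continuous_on {0..} (ys n) \<and>
      (\<forall>r\<ge>0. xl r \<le> xs n r \<and> xs n r \<le> xs (Suc n) r \<and> xs n r \<le> xu r \<and>
             yl r \<le> ys n r \<and> ys n r \<le> ys (Suc n) r \<and> ys n r \<le> yu r)" for n
  proof (induction n)
    case 0
    then show ?case using cont ord sub by (auto simp: start step)
  next
    case (Suc n)
    have nonneg: "0 \<le> xs n r" "0 \<le> ys n r" if "r \<ge> 0" for r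
      using Suc ord that by (meson order_trans)+
    have c: "continuous_on {0..} (xs (Suc n))" "continuous_on {0..} (ys (Suc n))"
      unfolding step using Suc pos nonneg
      by (auto intro!: pow_mean_continuous continuous_on_powr_nonneg)
    have up: "xs (Suc n) r \<le> xs (Suc (Suc n)) r" "ys (Suc n) r \<le> ys (Suc (Suc n)) r"
      if "r \<ge> 0" for r
      unfolding step(1)[of "Suc n"] step(2)[of "Suc n"] unfolding step(1)[of n] step(2)[of n]
      by (rule pow_mean_mono_powr; use Suc c nonneg pos that in \<open>simp add: step\<close>)+
    moreover have "xs (Suc n) r \<le> xu r" "ys (Suc n) r \<le> yu r" if "r \<ge> 0" for r
    proof -
      have "xs (Suc n) r \<le> pow_mean b1 (\<lambda>r. yu r powr p) r"
        "ys (Suc n) r \<le> pow_mean b2 (\<lambda>r. xu r powr q) r"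
        unfolding step by (rule pow_mean_mono_powr; use Suc cont nonneg pos that in simp)+
      then show "xs (Suc n) r \<le> xu r" "ys (Suc n) r \<le> yu r"
        using super that by (meson order_trans)+
    qed
    ultimately show ?case using c Suc by (meson order_trans)
  qed
  have nonneg: "0 \<le> xs n r" "0 \<le> ys n r" if "r \<ge> 0" for r n
    using inv ord that by (meson order_trans)+
  have "\<exists>l. (\<lambda>n. xs n r) \<longlonglongrightarrow> l" "\<exists>l. (\<lambda>n. ys n r) \<longlonglongrightarrow> l" if "r \<ge> 0" for r
    using inv that by (meson incseq_SucI incseq_convergent)+
  then obtain x y where lim: "\<And>r. r \<ge> 0 \<Longrightarrow> (\<lambda>n. xs n r) \<longlonglongrightarrow> x r"
      "\<And>r. r \<ge> 0 \<Longrightarrow> (\<lambda>n. ys n r) \<longlonglongrightarrow> y r"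
    by metis
  have between: "xl r \<le> x r \<and> x r \<le> xu r" "yl r \<le> y r \<and> y r \<le> yu r" if "r \<ge> 0" for r
    using inv that lim[OF that] by (meson LIMSEQ_le_const LIMSEQ_le_const2)+
  have cx: "continuous_on {0..} (xs n)" and cy: "continuous_on {0..} (ys n)" for n
    using inv[of n] by simp_all
  have mx: "xs n r \<le> xs (Suc n) r" and my: "ys n r \<le> ys (Suc n) r"
    and ux: "xs n r \<le> xu r" and uy: "ys n r \<le> yu r" if "r \<ge> 0" for n r
    using inv[of n] that by simp_all
  note limit_x = pow_mean_monotone_limit[OF pos(2,4) cx nonneg(1) mx cont(3) ux lim(1)]
  note limit_y = pow_mean_monotone_limit[OF pos(1,3) cy nonneg(2) my cont(4) uy lim(2)]
  have fix_x: "x r = pow_mean b1 (\<lambda>r. y r powr p) r"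
    and fix_y: "y r = pow_mean b2 (\<lambda>r. x r powr q) r" if "r \<ge> 0" for r
  proof -
    show "x r = pow_mean b1 (\<lambda>r. y r powr p) r"
      by (rule LIMSEQ_unique[OF LIMSEQ_Suc[OF lim(1)[OF that]]])
         (use limit_y(2)[OF _ _ _ _ that] in \<open>simp add: step\<close>)
    show "y r = pow_mean b2 (\<lambda>r. x r powr q) r"
      by (rule LIMSEQ_unique[OF LIMSEQ_Suc[OF lim(2)[OF that]]])
         (use limit_x(2)[OF _ _ _ _ that] in \<open>simp add: step\<close>)
  qed
  have cpm: "continuous_on {0<..} (pow_mean b1 (\<lambda>r. y r powr p))"
    "continuous_on {0<..} (pow_mean b2 (\<lambda>r. x r powr q))"
    by (rule pow_mean_continuous_pos[OF pos(1) limit_y(1)] pow_mean_continuous_pos[OF pos(2) limit_x(1)];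
        assumption)+
  have cpos: "continuous_on {0<..} x" "continuous_on {0<..} y"
    by (rule continuous_on_eq[OF cpm(1)], rule fix_x[symmetric], simp)
       (rule continuous_on_eq[OF cpm(2)], rule fix_y[symmetric], simp)
  have squeeze: "(f \<longlongrightarrow> f 0) (at_right 0)"
    if "continuous_on {0..} l" "continuous_on {0..} u" "l 0 = u 0"
      and le: "\<And>r. r \<ge> 0 \<Longrightarrow> l r \<le> f r \<and> f r \<le> u r" for f l u :: "real \<Rightarrow> real"
  proof -
    have "(l \<longlongrightarrow> l 0) (at_right 0)" "(u \<longlongrightarrow> u 0) (at_right 0)"
      using that(1,2)[unfolded continuous_on_def, THEN bspec, of 0]
      by (simp_all add: at_within_Ici_at_right)
    moreover have "f 0 = l 0" "f 0 = u 0" using le[of 0] that(3) by auto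
    ultimately show ?thesis
      by (intro tendsto_sandwich[of l f _ u])
         (use le in \<open>auto intro: eventually_mono[OF eventually_at_right_less[of 0]]\<close>)
  qed
  have "continuous_on {0..} x" "continuous_on {0..} y"
    by (rule continuous_on_halflineI[OF cpos(1)] continuous_on_halflineI[OF cpos(2)],
        rule squeeze[OF cont(1,3) touch(1)] squeeze[OF cont(2,4) touch(2)], rule between, assumption)+
  then show thesis using that between fix_x fix_y by blast
qed

section \<open>Barriers and the orbit that leaves the self-similar solution\<close>

lemma powr_ge_tangent:
  fixes y p :: real
  assumes "y \<ge> 0" "p \<ge> 1"
  shows "1 + p * (y - 1) \<le> y powr p"
proof (cases "y = 0")
  case False
  have "(y powr p) powr (1 / p) * 1 powr (1 - 1 / p) \<le> 1 / p * y powr p + (1 - 1 / p) * 1"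
    by (rule Youngs_inequality_0) (use assms False in auto)
  then have "y \<le> y powr p / p + 1 - 1 / p"
    using assms by (simp add: powr_powr)
  then have "p * y \<le> p * (y powr p / p + 1 - 1 / p)"
    using assms(2) by (intro mult_left_mono) auto
  also have "\<dots> = y powr p + p - 1"
    using assms(2) by (simp add: distrib_left right_diff_distrib)
  finally show ?thesis by (simp add: right_diff_distrib)
qed (use assms in simp)

lemma powr_le_tangent:
  fixes t P :: real
  assumes "t > 0" "0 \<le> P" "P \<le> 1"
  shows "t powr P \<le> 1 - P + P * t"
  using Youngs_inequality_0[of P "1 - P" t 1] assms by simp

text \<open>The eigenvector equation makes \<open>1 - s r\<^sup>l\<close> an exact solution of the linearised equation
  \<open>r f' = b (p (g - 1) - (f - 1))\<close>, where \<open>g = 1 - s' r\<^sup>l\<close>. The tangent of \<open>y \<mapsto> y\<^sup>p\<close> at \<open>1\<close> lies below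
  the graph, so it is a subsolution of the nonlinear equation; cutting off at \<open>0\<close> preserves this
  because the mean of a nonnegative function is nonnegative.\<close>

lemma lower_barrier:
  assumes pos: "b > 0" "l > 0" and "p \<ge> 1"
    and eigen: "(l + b) * s = b * p * s'" and "r \<ge> 0"
  shows "max 0 (1 - s * r powr l) \<le> pow_mean b (\<lambda>r. max 0 (1 - s' * r powr l) powr p) r"
proof -
  have cl: "continuous_on {0..} (\<lambda>r::real. r powr l)"
    using continuous_on_powr_nonneg[OF continuous_on_id \<open>l > 0\<close>] by simp
  have cg: "continuous_on {0..} (\<lambda>r. max 0 (1 - s' * r powr l) powr p)"
    by (rule continuous_on_powr_nonneg,
        intro continuous_on_max continuous_on_diff continuous_on_mult cl continuous_on_const)
       (use \<open>p \<ge> 1\<close> in auto)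
  have "1 - s * r powr l \<le> pow_mean b (\<lambda>r. max 0 (1 - s' * r powr l) powr p) r"
  proof (rule pow_mean_lower[OF \<open>b > 0\<close> cg])
    show "continuous_on {0..} (\<lambda>r. 1 - s * r powr l)"
      by (intro continuous_on_diff continuous_on_mult cl continuous_on_const)
    show "((\<lambda>r. 1 - s * r powr l) has_real_derivative - (s * (l * r powr (l - 1)))) (at r)"
      if "r > 0" for r
      using that by (auto intro!: derivative_eq_intros has_real_derivative_powr)
    show "1 - s * r powr l + r / b * - (s * (l * r powr (l - 1)))
        \<le> max 0 (1 - s' * r powr l) powr p" if "r > 0" for r
    proof -
      let ?y = "max 0 (1 - s' * r powr l)"
      have "r * r powr (l - 1) = r powr l" using that by (simp add: powr_diff)
      then have "r / b * - (s * (l * r powr (l - 1))) = - (s * l / b) * r powr l"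
        by (simp add: mult.left_commute)
      moreover have "s + s * l / b = p * s'"
        using eigen \<open>b > 0\<close> by (simp add: field_simps)
      ultimately have "1 - s * r powr l + r / b * - (s * (l * r powr (l - 1))) = 1 - (p * s') * r powr l"
        by (metis (no_types, opaque_lifting) diff_diff_eq distrib_right minus_mult_left uminus_add_conv_diff add.commute)
      also have "\<dots> = 1 + p * ((1 - s' * r powr l) - 1)" by simp
      also have "\<dots> \<le> 1 + p * (?y - 1)" using \<open>p \<ge> 1\<close> by (intro add_left_mono mult_left_mono) auto
      also have "\<dots> \<le> ?y powr p" by (rule powr_ge_tangent) (use \<open>p \<ge> 1\<close> in auto)
      finally show ?thesis .
    qed
  qed (use \<open>r \<ge> 0\<close> \<open>l > 0\<close> in auto)
  moreover have "pow_mean b (\<lambda>r. 0) r \<le> pow_mean b (\<lambda>r. max 0 (1 - s' * r powr l) powr p) r"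
    by (rule pow_mean_mono[OF \<open>r \<ge> 0\<close> _ _ pow_mean_integrable[OF \<open>b > 0\<close> cg]]) auto
  ultimately show ?thesis by (simp add: pow_mean_const \<open>r \<ge> 0\<close>)
qed

text \<open>Put \<open>h = r\<^sup>l\<close>, \<open>t = 1 / (1 + h)\<close> and \<open>P = s l / b\<close>. The eigenvector equation reads \<open>p s' = s + P\<close>, and the
  inequality needed for \<open>f = t\<^sup>s\<close> becomes \<open>t\<^sup>P \<le> 1 - P + P t\<close>, the concavity of \<open>t \<mapsto> t\<^sup>P\<close>. This holds
  for \<open>0 \<le> P \<le> 1\<close>, which is where the smallness \<open>s l \<le> b\<close> enters.\<close>

lemma upper_barrier:
  assumes pos: "b > 0" "l > 0" "s > 0"
    and eigen: "(l + b) * s = b * p * s'" and small: "s * l \<le> b" and "r \<ge> 0"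
  shows "pow_mean b (\<lambda>r. ((1 + r powr l) powr - s') powr p) r \<le> (1 + r powr l) powr - s"
proof -
  have cl: "continuous_on {0..} (\<lambda>r::real. 1 + r powr l)"
    using continuous_on_powr_nonneg[OF continuous_on_id \<open>l > 0\<close>]
    by (intro continuous_on_add continuous_on_const) simp
  have nz: "1 + r powr l \<noteq> 0" for r :: real
    using powr_ge_zero[of r l] by linarith
  have c: "continuous_on {0..} (\<lambda>r::real. (1 + r powr l) powr a)" for a
    by (rule continuous_on_powr[OF cl continuous_on_const]) (simp add: nz)
  show ?thesis
  proof (rule pow_mean_upper[OF \<open>b > 0\<close> _ c])
    show "continuous_on {0..} (\<lambda>r. ((1 + r powr l) powr - s') powr p)"
      using c[of "- s' * p"] by (simp add: powr_powr)
    show "((\<lambda>r. (1 + r powr l) powr - s) has_real_derivative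
        - s * (1 + r powr l) powr (- s - 1) * (l * r powr (l - 1))) (at r)" if "r > 0" for r
    proof -
      have "((\<lambda>r. 1 + r powr l) has_real_derivative l * r powr (l - 1)) (at r)"
        using that by (auto intro!: derivative_eq_intros has_real_derivative_powr)
      moreover have "1 + r powr l > 0" using powr_ge_zero[of r l] by linarith
      ultimately show ?thesis
        by (intro DERIV_chain2[where f = "\<lambda>t. t powr - s" and g = "\<lambda>r. 1 + r powr l"]
            has_real_derivative_powr)
    qed
    show "((1 + r powr l) powr - s') powr p \<le> (1 + r powr l) powr - s +
        r / b * (- s * (1 + r powr l) powr (- s - 1) * (l * r powr (l - 1)))" if "r > 0" for r
    proof -
      define h where "h = r powr l"
      have h: "h > 0" using that by (simp add: h_def)
      define P where "P = s * l / b"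
      have P: "0 \<le> P" "P \<le> 1" using pos small by (auto simp: P_def)
      have e: "s' * p = s + P" using eigen \<open>b > 0\<close> by (simp add: P_def field_simps)
      have rh: "r * r powr (l - 1) = h" using that by (simp add: powr_diff h_def)
      have "((1 + h) powr - s') powr p = (1 + h) powr (- s) * (1 / (1 + h)) powr P"
        using h e by (simp add: powr_powr powr_divide powr_minus_divide powr_add)
      also have "\<dots> \<le> (1 + h) powr (- s) * (1 - P + P * (1 / (1 + h)))"
        by (intro mult_left_mono powr_le_tangent P) (use h in auto)
      also have "1 - P + P * (1 / (1 + h)) = 1 - P * h / (1 + h)"
        using h by (simp add: field_simps)
      also have "(1 + h) powr (- s) * (1 - P * h / (1 + h))
          = (1 + h) powr - s + - s * ((1 + h) powr - s / (1 + h)) * l / b * h"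
        by (simp add: P_def algebra_simps)
      also have "(1 + h) powr - s / (1 + h) = (1 + h) powr (- s - 1)"
        using h by (simp add: powr_diff)
      also have "- s * (1 + h) powr (- s - 1) * l / b * h
          = r / b * (- s * (1 + h) powr (- s - 1) * (l * r powr (l - 1)))"
        by (simp add: rh[symmetric])
      finally show ?thesis by (simp add: h_def)
    qed
  qed (use \<open>r \<ge> 0\<close> \<open>l > 0\<close> in auto)
qed

text \<open>Convexity of \<open>t \<mapsto> t powr (-s)\<close> at \<open>t = 1\<close>.\<close>

lemma barriers_ordered:
  fixes l s r :: real
  assumes "s > 0"
  shows "max 0 (1 - s * r powr l) \<le> (1 + r powr l) powr - s"
proof -
  define h where "h = r powr l"
  have h: "h \<ge> 0" by (simp add: h_def)
  have "1 - s * h \<le> 1 + - s * ln (1 + h)"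
    using ln_add_one_self_le_self[OF h] assms by simp
  also have "\<dots> \<le> exp (- s * ln (1 + h))" by (rule exp_ge_add_one_self)
  also have "\<dots> = (1 + h) powr - s" using h by (simp add: powr_def)
  finally show ?thesis by (simp add: h_def)
qed

text \<open>The linearisation of the planar system at \<open>(1, 1)\<close> has negative determinant \<open>b\<^sub>1 b\<^sub>2 (1 - pq)\<close>, hence one
  positive eigenvalue \<open>l\<close>, with an eigenvector in the open quadrant. It is scaled to be as long as the
  constraints \<open>s\<^sub>i l \<le> b\<^sub>i\<close> permit, so that one of the upper barriers decays like \<open>r powr (-b\<^sub>i)\<close>.\<close>

lemma unstable_direction:
  assumes pos: "b1 > 0" "b2 > 0" "p > 0" "q > 0" and "p * q > (1::real)"
  obtains l s1 s2 :: real where "l > 0" "s1 > 0" "s2 > 0"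
    and "(l + b1) * s1 = b1 * p * s2" "(l + b2) * s2 = b2 * q * s1"
    and "s1 * l \<le> b1" "s2 * l \<le> b2" "s1 * l = b1 \<or> s2 * l = b2"
proof -
  \<comment> \<open>discriminant of the characteristic equation \<open>(l + b1) * (l + b2) = p * q * b1 * b2\<close>\<close>
  define D where "D = (b1 + b2)\<^sup>2 + 4 * (b1 * b2 * (p * q - 1))"
  have "b1 * b2 * (p * q - 1) > 0" using assms by simp
  then have D: "D > (b1 + b2)\<^sup>2" by (simp add: D_def)
  then have "sqrt D > b1 + b2" by (simp add: real_less_rsqrt)
  define l where "l = (sqrt D - (b1 + b2)) / 2"
  have l: "l > 0" using \<open>sqrt D > b1 + b2\<close> by (simp add: l_def)
  have "(2 * l + (b1 + b2))\<^sup>2 = D"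
    using order_trans[OF zero_le_power2 less_imp_le[OF D]] by (simp add: l_def field_simps)
  then have char: "(l + b1) * (l + b2) = p * q * b1 * b2"
    by (simp add: D_def power2_eq_square algebra_simps)
  define k where "k = min (1 / (p * l)) (b2 / (l * (l + b1)))"
  have k: "k > 0" using l pos by (simp add: k_def)
  show thesis
  proof (rule that[of l "k * (p * b1)" "k * (l + b1)"])
    have "(l + b2) * (k * (l + b1)) = k * ((l + b1) * (l + b2))" by (simp add: algebra_simps)
    then show "(l + b2) * (k * (l + b1)) = b2 * q * (k * (p * b1))"
      unfolding char by (simp add: algebra_simps)
    have "k \<le> 1 / (p * l)" "k \<le> b2 / (l * (l + b1))" by (simp_all add: k_def)
    then have "k * (p * l) \<le> 1" "k * (l * (l + b1)) \<le> b2"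
      using l pos by (simp_all add: pos_le_divide_eq del: distrib_left)
    then show "k * (p * b1) * l \<le> b1" "k * (l + b1) * l \<le> b2"
      using l pos mult_left_mono[of "k * (p * l)" 1 b1] by (simp_all add: mult_ac)
    have "k = 1 / (p * l) \<or> k = b2 / (l * (l + b1))" by (simp add: k_def min_def)
    then show "k * (p * b1) * l = b1 \<or> k * (l + b1) * l = b2"
      using l pos by (auto simp: add_pos_pos[THEN less_imp_neq[symmetric]])
    show "k * (l + b1) > 0" using l k pos by (intro mult_pos_pos add_pos_pos)
    show "(l + b1) * (k * (p * b1)) = b1 * p * (k * (l + b1))" by (simp add: algebra_simps)
  qed (use l k pos in simp_all)
qed

lemma upper_barrier_decay:
  fixes b l s r :: real
  assumes "s * l = b" "s > 0" "r > 0"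
  shows "(1 + r powr l) powr - s \<le> r powr - b"
proof -
  have "(1 + r powr l) powr - s \<le> (r powr l) powr - s"
    by (rule powr_mono2') (use assms in auto)
  then show ?thesis using assms(1) by (simp add: powr_powr mult.commute)
qed

theorem heteroclinic:
  assumes pos: "b1 > 0" "b2 > 0" and "p > 1" "q > (1::real)"
  obtains x y where "continuous_on {0..} x" "continuous_on {0..} y"
    and "\<And>r. r \<ge> 0 \<Longrightarrow> x r \<ge> 0" "\<And>r. r \<ge> 0 \<Longrightarrow> y r \<ge> 0" "x 0 = 1" "y 0 = 1"
    and "\<And>r. r \<ge> 0 \<Longrightarrow> x r = pow_mean b1 (\<lambda>r. y r powr p) r"
    and "\<And>r. r \<ge> 0 \<Longrightarrow> y r = pow_mean b2 (\<lambda>r. x r powr q) r"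
    and "(\<forall>r>0. x r \<le> r powr - b1) \<or> (\<forall>r>0. y r \<le> r powr - b2)"
proof -
  have pq: "p > 0" "q > 0" "p \<ge> 1" "q \<ge> 1" "p * q > 1"
    using assms less_1_mult by auto
  obtain l s1 s2 where l: "l > 0" and s: "s1 > 0" "s2 > 0"
    and e: "(l + b1) * s1 = b1 * p * s2" "(l + b2) * s2 = b2 * q * s1"
    and small: "s1 * l \<le> b1" "s2 * l \<le> b2" and sharp: "s1 * l = b1 \<or> s2 * l = b2"
    using unstable_direction[OF pos pq(1,2,5)] by metis
  define lo where "lo s r = max 0 (1 - s * r powr l)" for s r :: real
  define up where "up s r = (1 + r powr l) powr - s" for s r :: real
  have cl: "continuous_on {0..} (\<lambda>r::real. r powr l)"
    using continuous_on_powr_nonneg[OF continuous_on_id l] by simp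
  have clo: "continuous_on {0..} (lo s)" for s
    unfolding lo_def by (intro continuous_on_max continuous_on_diff continuous_on_mult cl continuous_on_const)
  have nz: "1 + r powr l \<noteq> 0" for r :: real
    using powr_ge_zero[of r l] by linarith
  have cup: "continuous_on {0..} (up s)" for s
    unfolding up_def
    by (rule continuous_on_powr) (auto intro!: continuous_on_add cl simp: nz)
  obtain x y where c: "continuous_on {0..} x" "continuous_on {0..} y"
    and bx: "\<And>r. r \<ge> 0 \<Longrightarrow> lo s1 r \<le> x r \<and> x r \<le> up s1 r"
    and by': "\<And>r. r \<ge> 0 \<Longrightarrow> lo s2 r \<le> y r \<and> y r \<le> up s2 r"
    and f: "\<And>r. r \<ge> 0 \<Longrightarrow> x r = pow_mean b1 (\<lambda>r. y r powr p) r"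
      "\<And>r. r \<ge> 0 \<Longrightarrow> y r = pow_mean b2 (\<lambda>r. x r powr q) r"
  proof (rule monotone_iteration[OF pos pq(1,2) clo clo cup cup])
    show "0 \<le> lo s1 r \<and> lo s1 r \<le> up s1 r" "0 \<le> lo s2 r \<and> lo s2 r \<le> up s2 r" for r
      using barriers_ordered[OF s(1)] barriers_ordered[OF s(2)] by (auto simp: lo_def up_def)
    show "lo s1 r \<le> pow_mean b1 (\<lambda>r. lo s2 r powr p) r"
      "lo s2 r \<le> pow_mean b2 (\<lambda>r. lo s1 r powr q) r" if "r \<ge> 0" for r
      unfolding lo_def
      by (rule lower_barrier[OF pos(1) l pq(3) e(1) that] lower_barrier[OF pos(2) l pq(4) e(2) that])+
    show "pow_mean b1 (\<lambda>r. up s2 r powr p) r \<le> up s1 r"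
      "pow_mean b2 (\<lambda>r. up s1 r powr q) r \<le> up s2 r" if "r \<ge> 0" for r
      unfolding up_def
      by (rule upper_barrier[OF pos(1) l s(1) e(1) small(1) that]
          upper_barrier[OF pos(2) l s(2) e(2) small(2) that])+
    show "lo s1 0 = up s1 0" "lo s2 0 = up s2 0"
      using l by (simp_all add: lo_def up_def)
  qed (rule that)
  have decay: "up s r \<le> r powr - b" if "s * l = b" "s > 0" "r > 0" for s r b
    unfolding up_def by (rule upper_barrier_decay[OF that])
  show thesis
  proof (rule that[OF c _ _ _ _ f])
    show "x r \<ge> 0" "y r \<ge> 0" if "r \<ge> 0" for r
      using bx[OF that] by'[OF that] by (auto simp: lo_def)
    show "x 0 = 1" "y 0 = 1"
      using bx[of 0] by'[of 0] l by (auto simp: lo_def up_def)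
    show "(\<forall>r>0. x r \<le> r powr - b1) \<or> (\<forall>r>0. y r \<le> r powr - b2)"
      using sharp
    proof
      assume "s1 * l = b1"
      then show ?thesis using decay[OF _ s(1)] bx by (meson less_imp_le order_trans)
    next
      assume "s2 * l = b2"
      then show ?thesis using decay[OF _ s(2)] by' by (meson less_imp_le order_trans)
    qed
  qed
qed

section \<open>Behaviour at the origin and at infinity\<close>

lemma mono_from_derivative:
  fixes f :: "real \<Rightarrow> real"
  assumes "\<And>r. r > a \<Longrightarrow> (f has_real_derivative f' r) (at r)" "\<And>r. r > a \<Longrightarrow> f' r \<ge> 0"
    and "a < r" "r \<le> s"
  shows "f r \<le> f s"
proof (rule DERIV_nonneg_imp_nondecreasing[OF assms(4)])
  fix x assume "r \<le> x"
  then have "x > a" using assms(3) by simp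
  then show "\<exists>y. (f has_real_derivative y) (at x) \<and> y \<ge> 0" using assms(1,2) by blast
qed

lemma bounded_monotone_limit:
  fixes f :: "real \<Rightarrow> real"
  assumes mono: "\<And>r s. 0 < r \<Longrightarrow> r \<le> s \<Longrightarrow> f r \<le> f s"
    and bdd: "eventually (\<lambda>r. f r \<le> B) at_top"
  obtains L where "(f \<longlongrightarrow> L) at_top" "\<And>r. r > 0 \<Longrightarrow> f r \<le> L"
proof -
  obtain R where R: "\<And>r. r \<ge> R \<Longrightarrow> f r \<le> B"
    using bdd by (auto simp: eventually_at_top_linorder)
  have "f r \<le> B" if "r > 0" for r
    using mono[OF that, of "max r R"] R[of "max r R"] by simp
  then have bd: "bdd_above (f ` {0<..})" by (auto intro!: bdd_aboveI2)
  define L where "L = Sup (f ` {0<..})"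
  have le: "f r \<le> L" if "r > 0" for r
    unfolding L_def by (rule cSup_upper[OF _ bd]) (use that in auto)
  have "(f \<longlongrightarrow> L) at_top"
  proof (rule order_tendstoI)
    fix a assume "a < L"
    then obtain s where s: "s > 0" "a < f s"
      unfolding L_def using less_cSup_iff[OF _ bd, of a] by auto
    show "eventually (\<lambda>r. a < f r) at_top"
      using eventually_ge_at_top[of s]
      by eventually_elim (use mono[OF s(1)] s(2) in force)
  next
    fix a assume "L < a"
    show "eventually (\<lambda>r. f r < a) at_top"
      using eventually_gt_at_top[of 0]
      by eventually_elim (use le \<open>L < a\<close> in force)
  qed
  then show thesis using that le by blast
qed

text \<open>Past the point where the bound holds, \<open>f + C r powr (1 - m) / (m - 1)\<close> is nonincreasing, which bounds the
  nondecreasing function \<open>f\<close>.\<close>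

lemma limit_of_fast_decay:
  fixes f f' :: "real \<Rightarrow> real"
  assumes D: "\<And>r. r > 0 \<Longrightarrow> (f has_real_derivative f' r) (at r)" "\<And>r. r > 0 \<Longrightarrow> f' r \<ge> 0"
    and decay: "eventually (\<lambda>r. f' r \<le> C * r powr - m) at_top" and "m > 1"
  obtains L where "(f \<longlongrightarrow> L) at_top" "\<And>r. r > 0 \<Longrightarrow> f r \<le> L"
proof -
  obtain R0 where R0: "\<And>r. r \<ge> R0 \<Longrightarrow> f' r \<le> C * r powr - m"
    using decay by (auto simp: eventually_at_top_linorder)
  define R where "R = max R0 1"
  have R: "R > 0" "\<And>r. r \<ge> R \<Longrightarrow> f' r \<le> C * r powr - m" using R0 by (auto simp: R_def)
  have "0 \<le> C * R powr - m" using R D(2)[OF R(1)] by (meson order_refl order_trans)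
  then have C: "C \<ge> 0" using R(1) by (simp add: zero_le_mult_iff)
  define h where "h r = f r + C / (m - 1) * r powr (1 - m)" for r
  have h: "h r \<le> h R" if "r \<ge> R" for r
  proof (rule DERIV_nonpos_imp_nonincreasing[OF that])
    fix s assume s: "R \<le> s"
    then have "s > 0" using R(1) by simp
    have "(h has_real_derivative f' s + C / (m - 1) * ((1 - m) * s powr (1 - m - 1))) (at s)"
      unfolding h_def[abs_def]
      by (intro DERIV_add D(1) DERIV_cmult has_real_derivative_powr \<open>s > 0\<close>)
    moreover have "C / (m - 1) * ((1 - m) * s powr (1 - m - 1)) = - (C * s powr - m)"
    proof -
      have "C / (m - 1) * (1 - m) = - C" using \<open>m > 1\<close> by (simp add: field_simps)
      then have "C / (m - 1) * (1 - m) * s powr - m = - C * s powr - m" by simp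
      then show ?thesis by (simp add: mult.assoc)
    qed
    ultimately have "(h has_real_derivative f' s - C * s powr - m) (at s)" by simp
    moreover have "f' s - C * s powr - m \<le> 0" using R(2)[OF s] by simp
    ultimately show "\<exists>y. (h has_real_derivative y) (at s) \<and> y \<le> 0" by blast
  qed
  show thesis
  proof (rule bounded_monotone_limit[of f])
    show "f r \<le> f s" if "0 < r" "r \<le> s" for r s
      by (rule mono_from_derivative[OF D that])
    have "f r \<le> h R" if "r \<ge> R" for r
    proof -
      have "0 \<le> C / (m - 1) * r powr (1 - m)" using C \<open>m > 1\<close> by simp
      then have "f r \<le> h r" by (simp add: h_def)
      then show ?thesis using h[OF that] by simp
    qed
    then show "eventually (\<lambda>r. f r \<le> h R) at_top"
      unfolding eventually_at_top_linorder by blast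
  qed (rule that)
qed

lemma limit_of_power_decay:
  fixes f f' :: "real \<Rightarrow> real"
  assumes D: "\<And>r. r > 0 \<Longrightarrow> (f has_real_derivative f' r) (at r)" "\<And>r. r > 0 \<Longrightarrow> f' r \<ge> 0"
    and lim: "((\<lambda>r. r powr m * f' r) \<longlongrightarrow> k) at_top" and "m > 1"
  obtains L where "(f \<longlongrightarrow> L) at_top" "\<And>r. r > 0 \<Longrightarrow> f r \<le> L"
proof -
  have "eventually (\<lambda>r. r powr m * f' r < k + 1) at_top"
    by (rule order_tendstoD(2)[OF lim]) simp
  then have "eventually (\<lambda>r. f' r \<le> (k + 1) * r powr - m) at_top"
    using eventually_gt_at_top[of 0]
    by eventually_elim (simp add: powr_minus field_simps)
  from limit_of_fast_decay[OF D this \<open>m > 1\<close>] that show thesis by blast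
qed

text \<open>If the nondecreasing flux were \<open>-c < 0\<close> at \<open>r\<close>, then \<open>w s \<le> -c / s\<close> for small \<open>s\<close> (this is where \<open>\<nu> \<ge> 1\<close>
  is used), and \<open>\<phi>\<close> would grow at least like \<open>-c ln s\<close> towards the origin.\<close>

lemma flux_nonneg:
  fixes \<phi> w W' :: "real \<Rightarrow> real"
  assumes D: "\<And>r. r > 0 \<Longrightarrow> (\<phi> has_real_derivative w r) (at r)"
    and W: "\<And>r. r > 0 \<Longrightarrow> ((\<lambda>r. r powr \<nu> * w r) has_real_derivative W' r) (at r)"
      "\<And>r. r > 0 \<Longrightarrow> W' r \<ge> 0"
    and bdd: "\<And>r. r > 0 \<Longrightarrow> \<phi> r \<le> B" and "\<nu> \<ge> 1" and "r > 0"
  shows "w r \<ge> 0"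
proof (rule ccontr)
  assume "\<not> w r \<ge> 0"
  define c where "c = - (r powr \<nu> * w r)"
  have c: "c > 0" using \<open>\<not> w r \<ge> 0\<close> \<open>r > 0\<close> by (simp add: c_def mult_pos_neg)
  define R where "R = min r 1"
  have R: "R > 0" "R \<le> r" "R \<le> 1" using \<open>r > 0\<close> by (auto simp: R_def)
  have w: "w s \<le> - c / s" if "0 < s" "s \<le> R" for s
  proof -
    have "s powr \<nu> * w s \<le> r powr \<nu> * w r"
      by (rule mono_from_derivative[OF W]) (use that R in auto)
    then have "s powr \<nu> * w s \<le> - c" by (simp add: c_def)
    then have "w s \<le> - c / s powr \<nu>"
      using that by (subst pos_le_divide_eq) (simp_all add: mult.commute)
    also have "\<dots> \<le> - c / s"
    proof -
      have "s powr \<nu> \<le> s powr 1" using that R \<open>\<nu> \<ge> 1\<close> by (intro powr_mono') auto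
      then show ?thesis using that c by (simp add: frac_le)
    qed
    finally show ?thesis .
  qed
  define g where "g s = \<phi> s + c * ln s" for s
  have g: "g R \<le> g s" if "0 < s" "s \<le> R" for s
  proof (rule DERIV_nonpos_imp_nonincreasing[OF that(2)])
    fix t assume t: "s \<le> t" "t \<le> R"
    then have "t > 0" using that by simp
    have "(g has_real_derivative w t + c * (1 / t)) (at t)"
      unfolding g_def[abs_def] using \<open>t > 0\<close>
      by (intro DERIV_add D DERIV_cmult) (auto intro!: derivative_eq_intros)
    moreover have "w t + c * (1 / t) \<le> 0" using w[OF \<open>t > 0\<close> t(2)] by simp
    ultimately show "\<exists>y. (g has_real_derivative y) (at t) \<and> y \<le> 0" by blast
  qed
  \<comment> \<open>far enough along \<open>s = exp (- t)\<close> for \<open>- c * ln s\<close> to exceed the bound on \<open>\<phi>\<close>\<close>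
  define t where "t = max (- ln R) ((B - g R) / c + 1)"
  have "exp (- t) \<le> exp (ln R)" unfolding exp_le_cancel_iff by (simp add: t_def)
  then have "exp (- t) \<le> R" using R(1) by simp
  from g[OF _ this] have "g R + c * t \<le> \<phi> (exp (- t))" by (simp add: g_def)
  also have "\<dots> \<le> B" by (rule bdd) simp
  finally have "t \<le> (B - g R) / c" using c by (simp add: field_simps)
  then show False by (simp add: t_def)
qed

text \<open>By l'Hopital: the derivative of \<open>r powr \<nu> * w\<^sub>2\<close> is \<open>(r powr \<nu> * |w\<^sub>1|)\<^sup>q * r powr (\<nu> - \<nu> q)\<close>, whose first factor
  tends to \<open>k\<^sup>q\<close>.\<close>

lemma second_flux_limit:
  fixes w1 w2 :: "real \<Rightarrow> real"
  assumes W2: "\<And>r. r > 0 \<Longrightarrow>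
      ((\<lambda>r. r powr \<nu> * w2 r) has_real_derivative r powr \<nu> * \<bar>w1 r\<bar> powr q) (at r)"
    and lim: "((\<lambda>r. r powr \<nu> * w1 r) \<longlongrightarrow> k) at_top" and "k > 0"
    and b: "\<nu> + 1 - \<nu> * q > 0"
  shows "((\<lambda>r. r powr (\<nu> * q - 1) * w2 r) \<longlongrightarrow> k powr q / (\<nu> + 1 - \<nu> * q)) at_top"
proof -
  let ?b = "\<nu> + 1 - \<nu> * q"
  have "((\<lambda>r. r powr \<nu> * w2 r / r powr ?b) \<longlongrightarrow> k powr q / ?b) at_top"
  proof (rule lhospital_at_top_at_top)
    show "LIM r at_top. r powr ?b :> at_top" using b by real_asymp
    show "\<forall>\<^sub>F r in at_top. ?b * r powr (?b - 1) \<noteq> 0"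
      using eventually_gt_at_top[of 0] by eventually_elim (use b in simp)
    show "\<forall>\<^sub>F r in at_top. ((\<lambda>r. r powr \<nu> * w2 r) has_real_derivative r powr \<nu> * \<bar>w1 r\<bar> powr q) (at r)"
      using eventually_gt_at_top[of 0] by eventually_elim (rule W2)
    show "\<forall>\<^sub>F r in at_top. ((\<lambda>r. r powr ?b) has_real_derivative ?b * r powr (?b - 1)) (at r)"
      using eventually_gt_at_top[of 0] by eventually_elim (rule has_real_derivative_powr)
    have "((\<lambda>r. \<bar>r powr \<nu> * w1 r\<bar> powr q / ?b) \<longlongrightarrow> k powr q / ?b) at_top"
      using \<open>k > 0\<close> b tendsto_powr[OF tendsto_rabs[OF lim] tendsto_const, of q]
      by (intro tendsto_divide tendsto_const) auto
    moreover have "\<forall>\<^sub>F r in at_top. \<bar>r powr \<nu> * w1 r\<bar> powr q / ?b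
        = r powr \<nu> * \<bar>w1 r\<bar> powr q / (?b * r powr (?b - 1))"
      using eventually_gt_at_top[of 0]
    proof eventually_elim
      case (elim r)
      have "\<bar>r powr \<nu> * w1 r\<bar> powr q = r powr (\<nu> * q) * \<bar>w1 r\<bar> powr q"
        by (simp add: abs_mult powr_mult powr_powr)
      also have "r powr (\<nu> * q) = r powr \<nu> / r powr (?b - 1)"
        using elim by (simp add: powr_diff[symmetric])
      finally show ?case by simp
    qed
    ultimately show "((\<lambda>r. r powr \<nu> * \<bar>w1 r\<bar> powr q / (?b * r powr (?b - 1))) \<longlongrightarrow> k powr q / ?b) at_top"
      by (rule Lim_transform_eventually)
  qed
  moreover have "\<forall>\<^sub>F r in at_top. r powr \<nu> * w2 r / r powr ?b = r powr (\<nu> * q - 1) * w2 r"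
    using eventually_gt_at_top[of 0]
  proof eventually_elim
    case (elim r)
    have "r powr (\<nu> * q - 1) = r powr \<nu> / r powr ?b"
      using elim by (simp add: powr_diff[symmetric] algebra_simps)
    then show ?case by simp
  qed
  ultimately show ?thesis by (rule Lim_transform_eventually)
qed

section \<open>Self-similar profiles\<close>

text \<open>The exponents \<open>-\<alpha>\<^sub>i\<close> and amplitudes \<open>A\<^sub>i\<close> are those of the derivatives of the self-similar solution. The
  \<open>scale\<close> and \<open>balance\<close> equations say that \<open>A\<^sub>i r powr (-\<alpha>\<^sub>i)\<close> solves the first-order system; \<open>nup\<close>
  makes the flux of the first component converge at infinity.\<close>

locale similarity =
  fixes \<nu> p q \<alpha>1 \<alpha>2 A1 A2 :: real
  assumes p1: "p > 1" and q1: "q > 1" and nu: "\<nu> \<ge> 2" and nup: "\<nu> * (p - 1) > 1"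
    and al: "\<alpha>1 < 1" "\<alpha>2 < 1"
    and scale: "p * \<alpha>2 = \<alpha>1 + 1" "q * \<alpha>1 = \<alpha>2 + 1"
    and A: "A1 > 0" "A2 > 0"
    and balance: "A1 * (\<nu> - \<alpha>1) = A2 powr p" "A2 * (\<nu> - \<alpha>2) = A1 powr q"
begin

text \<open>The antiderivative of \<open>A r powr (-\<alpha>) * x r\<close> that vanishes at \<open>0\<close>. Written with a power mean, its
  quotient by the self-similar profile is that mean, which tends to \<open>x 0\<close> at the origin.\<close>

definition profile :: "real \<Rightarrow> real \<Rightarrow> (real \<Rightarrow> real) \<Rightarrow> real \<Rightarrow> real" where
  "profile A \<alpha> x r = A / (1 - \<alpha>) * r powr (1 - \<alpha>) * pow_mean (1 - \<alpha>) x r"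

lemma profile_derivative:
  assumes "\<alpha> < 1" "continuous_on {0..} x" "r > 0"
  shows "(profile A \<alpha> x has_real_derivative A * r powr - \<alpha> * x r) (at r)"
proof -
  have "((\<lambda>r. A / (1 - \<alpha>) * (r powr (1 - \<alpha>) * pow_mean (1 - \<alpha>) x r)) has_real_derivative
      A / (1 - \<alpha>) * ((1 - \<alpha>) * r powr (1 - \<alpha> - 1) * x r)) (at r)"
    by (intro DERIV_cmult pow_mean_has_derivative) (use assms in auto)
  then show ?thesis using assms(1) by (simp add: profile_def[abs_def] mult.assoc)
qed

lemma profile_nonneg:
  assumes "\<alpha> < 1" "continuous_on {0..} x" "\<And>r. r \<ge> 0 \<Longrightarrow> x r \<ge> 0" "A > 0" "r \<ge> 0"
  shows "profile A \<alpha> x r \<ge> 0"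
proof -
  have "pow_mean (1 - \<alpha>) (\<lambda>_. 0) r \<le> pow_mean (1 - \<alpha>) x r"
    using assms by (intro pow_mean_mono pow_mean_integrable) auto
  then show ?thesis using assms by (simp add: profile_def pow_mean_const)
qed

lemma profile_asymptotic:
  assumes "\<alpha> < 1" "continuous_on {0..} x" "x 0 = 1" "A > 0"
  shows "((\<lambda>r. profile A \<alpha> x r / (A / (1 - \<alpha>) * r powr (1 - \<alpha>))) \<longlongrightarrow> 1) (at_right 0)"
proof -
  have "(pow_mean (1 - \<alpha>) x \<longlongrightarrow> pow_mean (1 - \<alpha>) x 0) (at 0 within {0..})"
    using pow_mean_continuous[OF _ assms(2), of "1 - \<alpha>"] assms(1) by (simp add: continuous_on_def)
  then have "(pow_mean (1 - \<alpha>) x \<longlongrightarrow> 1) (at_right 0)"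
    by (simp add: at_within_Ici_at_right pow_mean_def assms(3))
  moreover have "\<forall>\<^sub>F r in at_right 0.
      pow_mean (1 - \<alpha>) x r = profile A \<alpha> x r / (A / (1 - \<alpha>) * r powr (1 - \<alpha>))"
    using eventually_at_right_less[of 0]
    by eventually_elim (use assms in \<open>simp add: profile_def\<close>)
  ultimately show ?thesis by (rule Lim_transform_eventually)
qed

lemma flux_of_fixed_point:
  assumes "\<alpha> < 1" "continuous_on {0..} y" "\<And>r. r \<ge> 0 \<Longrightarrow> y r \<ge> 0" "r > 0" "a > 0" "B > 0"
    and "a * \<alpha>' = \<alpha> + 1" "A * (\<nu> - \<alpha>) = B powr a"
    and x: "\<And>r. r \<ge> 0 \<Longrightarrow> x r = pow_mean (\<nu> - \<alpha>) (\<lambda>r. y r powr a) r"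
  shows "((\<lambda>r. r powr \<nu> * (A * r powr - \<alpha> * x r)) has_real_derivative
           r powr \<nu> * \<bar>B * r powr - \<alpha>' * y r\<bar> powr a) (at r)"
proof -
  have b: "\<nu> - \<alpha> > 0" using nu assms(1) by simp
  have D: "((\<lambda>r. A * (r powr (\<nu> - \<alpha>) * pow_mean (\<nu> - \<alpha>) (\<lambda>r. y r powr a) r)) has_real_derivative
      A * ((\<nu> - \<alpha>) * r powr (\<nu> - \<alpha> - 1) * y r powr a)) (at r)"
    by (intro DERIV_cmult pow_mean_has_derivative continuous_on_powr_nonneg) (use assms b in auto)
  have "- \<alpha>' * a = - \<alpha> - 1" using assms(7) by (simp add: mult.commute)
  then have pw: "r powr (\<nu> - \<alpha> - 1) = r powr \<nu> * r powr (- \<alpha>' * a)"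
    by (simp add: powr_add[symmetric] algebra_simps)
  have "\<bar>B * r powr - \<alpha>' * y r\<bar> powr a = B powr a * r powr (- \<alpha>' * a) * y r powr a"
    using assms(3)[of r] assms(4,6) by (simp add: powr_mult powr_powr abs_mult)
  then have e: "A * ((\<nu> - \<alpha>) * r powr (\<nu> - \<alpha> - 1) * y r powr a)
      = r powr \<nu> * \<bar>B * r powr - \<alpha>' * y r\<bar> powr a"
    unfolding pw using assms(8)[symmetric] by (simp only: mult_ac)
  show ?thesis
    by (rule has_field_derivative_transform_within_open[OF D[unfolded e] open_greaterThan[of 0]])
       (use assms(4) x in \<open>auto simp: powr_diff powr_minus field_simps\<close>)
qed

lemma radial_system_of_fixed_point:
  assumes c: "continuous_on {0..} x" "continuous_on {0..} y"
    and nonneg: "\<And>r. r \<ge> 0 \<Longrightarrow> x r \<ge> 0" "\<And>r. r \<ge> 0 \<Longrightarrow> y r \<ge> 0"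
    and x: "\<And>r. r \<ge> 0 \<Longrightarrow> x r = pow_mean (\<nu> - \<alpha>1) (\<lambda>r. y r powr p) r"
    and y: "\<And>r. r \<ge> 0 \<Longrightarrow> y r = pow_mean (\<nu> - \<alpha>2) (\<lambda>r. x r powr q) r"
  shows "radial_system \<nu> p q (profile A1 \<alpha>1 x) (profile A2 \<alpha>2 y)
           (\<lambda>r. A1 * r powr - \<alpha>1 * x r) (\<lambda>r. A2 * r powr - \<alpha>2 * y r)"
  unfolding radial_system_def
  using profile_derivative[OF al(1) c(1)] profile_derivative[OF al(2) c(2)]
    flux_of_fixed_point[OF al(1) c(2) nonneg(2) _ _ A(2) scale(1) balance(1) x]
    flux_of_fixed_point[OF al(2) c(1) nonneg(1) _ _ A(1) scale(2) balance(2) y] p1 q1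
  by simp

text \<open>The equilibrium \<open>x = y = 1\<close>.\<close>

lemma particular_system:
  "radial_system \<nu> p q (\<lambda>r. A1 / (1 - \<alpha>1) * r powr (1 - \<alpha>1)) (\<lambda>r. A2 / (1 - \<alpha>2) * r powr (1 - \<alpha>2))
     (\<lambda>r. A1 * r powr - \<alpha>1) (\<lambda>r. A2 * r powr - \<alpha>2)"
proof -
  have "radial_system \<nu> p q (profile A1 \<alpha>1 (\<lambda>_. 1)) (profile A2 \<alpha>2 (\<lambda>_. 1))
           (\<lambda>r. A1 * r powr - \<alpha>1 * 1) (\<lambda>r. A2 * r powr - \<alpha>2 * 1)"
    by (rule radial_system_of_fixed_point) (auto simp: pow_mean_const)
  moreover have "((\<lambda>r. A / (1 - \<alpha>) * r powr (1 - \<alpha>)) has_real_derivative D) (at r)"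
    if "(profile A \<alpha> (\<lambda>_. 1) has_real_derivative D) (at r)" "r > 0" for A \<alpha> D r
    by (rule has_field_derivative_transform_within_open[OF that(1) open_greaterThan[of 0]])
       (use that(2) in \<open>auto simp: profile_def pow_mean_const\<close>)
  ultimately show ?thesis by (simp add: radial_system_def)
qed

text \<open>The orbit of \<open>heteroclinic\<close>, translated back. One of the two components is known to decay at its optimal
  rate. If it is the first, the first flux is bounded by \<open>A\<^sub>1\<close> directly; if it is the second, the
  derivative of the first flux is integrable. After that \<open>w\<^sub>1 \<le> k r powr (-\<nu>)\<close>, and the remaining limits follow
  in this order: second flux, first profile, second profile.\<close>

theorem crossing_solution:
  assumes noncritical: "\<nu> * q \<noteq> \<nu> + 1"
  obtains \<phi>1 \<phi>2 w1 w2 c1 c2 k where "radial_system \<nu> p q \<phi>1 \<phi>2 w1 w2"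
    and "\<And>r. r > 0 \<Longrightarrow> 0 \<le> \<phi>1 r \<and> \<phi>1 r \<le> c1" "\<And>r. r > 0 \<Longrightarrow> 0 \<le> \<phi>2 r \<and> \<phi>2 r \<le> c2"
    and "((\<lambda>r. \<phi>1 r / (A1 / (1 - \<alpha>1) * r powr (1 - \<alpha>1))) \<longlongrightarrow> 1) (at_right 0)"
    and "((\<lambda>r. \<phi>2 r / (A2 / (1 - \<alpha>2) * r powr (1 - \<alpha>2))) \<longlongrightarrow> 1) (at_right 0)"
    and "(\<phi>1 \<longlongrightarrow> c1) at_top" "(\<phi>2 \<longlongrightarrow> c2) at_top"
    and "((\<lambda>r. r powr \<nu> * w1 r) \<longlongrightarrow> k) at_top" "k > 0"
    and "\<nu> * q > \<nu> + 1 \<longrightarrow> (\<exists>k2>0. ((\<lambda>r. r powr \<nu> * w2 r) \<longlongrightarrow> k2) at_top)"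
proof -
  obtain x y where c: "continuous_on {0..} x" "continuous_on {0..} y"
    and nonneg: "\<And>r. r \<ge> 0 \<Longrightarrow> x r \<ge> 0" "\<And>r. r \<ge> 0 \<Longrightarrow> y r \<ge> 0" and one: "x 0 = 1" "y 0 = 1"
    and fp: "\<And>r. r \<ge> 0 \<Longrightarrow> x r = pow_mean (\<nu> - \<alpha>1) (\<lambda>r. y r powr p) r"
      "\<And>r. r \<ge> 0 \<Longrightarrow> y r = pow_mean (\<nu> - \<alpha>2) (\<lambda>r. x r powr q) r"
    and decay: "(\<forall>r>0. x r \<le> r powr - (\<nu> - \<alpha>1)) \<or> (\<forall>r>0. y r \<le> r powr - (\<nu> - \<alpha>2))"
  proof (rule heteroclinic[of "\<nu> - \<alpha>1" "\<nu> - \<alpha>2" p q])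
    show "\<nu> - \<alpha>1 > 0" "\<nu> - \<alpha>2 > 0" using al nu by simp_all
  qed (rule p1, rule q1, rule that)
  define \<phi>1 where "\<phi>1 = profile A1 \<alpha>1 x"
  define \<phi>2 where "\<phi>2 = profile A2 \<alpha>2 y"
  define w1 where "w1 r = A1 * r powr - \<alpha>1 * x r" for r
  define w2 where "w2 r = A2 * r powr - \<alpha>2 * y r" for r
  have sys: "radial_system \<nu> p q \<phi>1 \<phi>2 w1 w2"
    unfolding \<phi>1_def \<phi>2_def w1_def[abs_def] w2_def[abs_def]
    by (rule radial_system_of_fixed_point[OF c nonneg fp])
  have D1: "(\<phi>1 has_real_derivative w1 r) (at r)" and D2: "(\<phi>2 has_real_derivative w2 r) (at r)"
    and W1: "((\<lambda>r. r powr \<nu> * w1 r) has_real_derivative r powr \<nu> * \<bar>w2 r\<bar> powr p) (at r)"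
    and W2: "((\<lambda>r. r powr \<nu> * w2 r) has_real_derivative r powr \<nu> * \<bar>w1 r\<bar> powr q) (at r)"
    if "r > 0" for r
    using sys that by (auto simp: radial_system_def)
  have w: "w1 r \<ge> 0" "w2 r \<ge> 0" if "r > 0" for r
    using that A nonneg by (simp_all add: w1_def w2_def)
  obtain s where s: "s > 0" "w1 s > 0" "w2 s > 0"
  proof -
    have "(x \<longlongrightarrow> 1) (at_right 0)" "(y \<longlongrightarrow> 1) (at_right 0)"
      using c[unfolded continuous_on_def, THEN bspec, of 0] one
      by (simp_all add: at_within_Ici_at_right)
    then have "eventually (\<lambda>r. x r > 0) (at_right 0)" "eventually (\<lambda>r. y r > 0) (at_right 0)"
      by (auto elim: order_tendstoD(1))
    then have "eventually (\<lambda>r. r > 0 \<and> w1 r > 0 \<and> w2 r > 0) (at_right 0)"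
      using eventually_at_right_less[of 0]
      by eventually_elim (use A in \<open>simp add: w1_def w2_def\<close>)
    from eventually_happens'[OF trivial_limit_at_right_real this] that show thesis by blast
  qed
  have "\<exists>k. ((\<lambda>r. r powr \<nu> * w1 r) \<longlongrightarrow> k) at_top \<and> (\<forall>r>0. r powr \<nu> * w1 r \<le> k)"
    using decay
  proof
    assume x: "\<forall>r>0. x r \<le> r powr - (\<nu> - \<alpha>1)"
    have "r powr \<nu> * w1 r \<le> A1" if "r > 0" for r
    proof -
      have "r powr \<nu> * w1 r \<le> r powr \<nu> * (A1 * r powr - \<alpha>1 * r powr - (\<nu> - \<alpha>1))"
        unfolding w1_def using x that A by (intro mult_left_mono) auto
      also have "\<dots> = A1" using that by (simp add: powr_diff powr_minus)
      finally show ?thesis .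
    qed
    then have "eventually (\<lambda>r. r powr \<nu> * w1 r \<le> A1) at_top"
      by (rule eventually_mono[OF eventually_gt_at_top[of 0]])
    moreover have "r powr \<nu> * w1 r \<le> t powr \<nu> * w1 t" if "0 < r" "r \<le> t" for r t
      by (rule mono_from_derivative[OF W1 _ that]) auto
    ultimately obtain k where "((\<lambda>r. r powr \<nu> * w1 r) \<longlongrightarrow> k) at_top" "\<And>r. r > 0 \<Longrightarrow> r powr \<nu> * w1 r \<le> k"
      using bounded_monotone_limit[of "\<lambda>r. r powr \<nu> * w1 r" A1] by blast
    then show ?thesis by blast
  next
    assume y: "\<forall>r>0. y r \<le> r powr - (\<nu> - \<alpha>2)"
    have "r powr \<nu> * \<bar>w2 r\<bar> powr p \<le> A2 powr p * r powr - (\<nu> * (p - 1))" if "r > 0" for r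
    proof -
      have "w2 r \<le> A2 * r powr - \<alpha>2 * r powr - (\<nu> - \<alpha>2)"
        unfolding w2_def using y that A by (intro mult_left_mono) auto
      also have "\<dots> = A2 * r powr - \<nu>" by (simp add: powr_add[symmetric])
      finally have "\<bar>w2 r\<bar> powr p \<le> (A2 * r powr - \<nu>) powr p"
        using w(2)[OF that] p1 by (intro powr_mono2) auto
      also have "\<dots> = A2 powr p * r powr - (\<nu> * p)"
        using A by (simp add: powr_mult powr_powr)
      finally have "r powr \<nu> * \<bar>w2 r\<bar> powr p \<le> r powr \<nu> * (A2 powr p * r powr - (\<nu> * p))"
        by (intro mult_left_mono) auto
      also have "\<dots> = A2 powr p * (r powr \<nu> * r powr - (\<nu> * p))" by simp
      also have "r powr \<nu> * r powr - (\<nu> * p) = r powr - (\<nu> * (p - 1))"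
        by (simp add: powr_add[symmetric] algebra_simps)
      finally show ?thesis .
    qed
    then have "eventually (\<lambda>r. r powr \<nu> * \<bar>w2 r\<bar> powr p \<le> A2 powr p * r powr - (\<nu> * (p - 1))) at_top"
      by (rule eventually_mono[OF eventually_gt_at_top[of 0]])
    moreover have "r powr \<nu> * \<bar>w2 r\<bar> powr p \<ge> 0" for r by simp
    ultimately obtain k where "((\<lambda>r. r powr \<nu> * w1 r) \<longlongrightarrow> k) at_top" "\<And>r. r > 0 \<Longrightarrow> r powr \<nu> * w1 r \<le> k"
      using limit_of_fast_decay[OF W1 _ _ nup] by blast
    then show ?thesis by blast
  qed
  then obtain k where k: "((\<lambda>r. r powr \<nu> * w1 r) \<longlongrightarrow> k) at_top"
    and k_le: "\<And>r. r > 0 \<Longrightarrow> r powr \<nu> * w1 r \<le> k" by blast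
  have "0 < s powr \<nu> * w1 s" using s by simp
  with k_le[OF s(1)] have "k > 0" by linarith
  have w1_le: "w1 r \<le> k * r powr - \<nu>" if "r > 0" for r
    using k_le[OF that] that by (simp add: powr_minus field_simps)
  have nu1: "\<nu> > 1" using nu by simp
  have supercritical: "\<exists>k2>0. ((\<lambda>r. r powr \<nu> * w2 r) \<longlongrightarrow> k2) at_top" if "\<nu> * q > \<nu> + 1"
  proof -
    have "r powr \<nu> * \<bar>w1 r\<bar> powr q \<le> k powr q * r powr - (\<nu> * (q - 1))" if "r > 0" for r
    proof -
      have "\<bar>w1 r\<bar> powr q \<le> (k * r powr - \<nu>) powr q"
        using w(1)[OF that] w1_le[OF that] q1 by (intro powr_mono2) auto
      also have "\<dots> = k powr q * r powr - (\<nu> * q)"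
        using \<open>k > 0\<close> by (simp add: powr_mult powr_powr)
      finally have "r powr \<nu> * \<bar>w1 r\<bar> powr q \<le> r powr \<nu> * (k powr q * r powr - (\<nu> * q))"
        by (intro mult_left_mono) auto
      also have "\<dots> = k powr q * (r powr \<nu> * r powr - (\<nu> * q))" by simp
      also have "r powr \<nu> * r powr - (\<nu> * q) = r powr - (\<nu> * (q - 1))"
        by (simp add: powr_add[symmetric] algebra_simps)
      finally show ?thesis .
    qed
    then have ev: "eventually (\<lambda>r. r powr \<nu> * \<bar>w1 r\<bar> powr q \<le> k powr q * r powr - (\<nu> * (q - 1))) at_top"
      by (rule eventually_mono[OF eventually_gt_at_top[of 0]])
    have "\<nu> * (q - 1) > 1" using that by (simp add: algebra_simps)
    moreover have "r powr \<nu> * \<bar>w1 r\<bar> powr q \<ge> 0" for r by simp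
    ultimately obtain k2 where k2: "((\<lambda>r. r powr \<nu> * w2 r) \<longlongrightarrow> k2) at_top" "\<And>r. r > 0 \<Longrightarrow> r powr \<nu> * w2 r \<le> k2"
      using limit_of_fast_decay[OF W2 _ ev] by blast
    have "0 < s powr \<nu> * w2 s" using s by simp
    with k2(2)[OF s(1)] have "k2 > 0" by linarith
    with k2(1) show ?thesis by blast
  qed
  obtain c1 where c1: "(\<phi>1 \<longlongrightarrow> c1) at_top" "\<And>r. r > 0 \<Longrightarrow> \<phi>1 r \<le> c1"
    using limit_of_power_decay[OF D1 w(1) k nu1] by blast
  obtain m k' where "m > 1" "((\<lambda>r. r powr m * w2 r) \<longlongrightarrow> k') at_top"
  proof (cases "\<nu> * q > \<nu> + 1")
    case True
    then show thesis using supercritical nu1 that by blast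
  next
    case False
    with noncritical have b: "\<nu> + 1 - \<nu> * q > 0" by simp
    have "\<nu> * q > \<nu> * 1" using nu q1 by (intro mult_strict_left_mono) auto
    then have "\<nu> * q - 1 > 1" using nu by linarith
    then show thesis using that second_flux_limit[OF W2 k \<open>k > 0\<close> b] by blast
  qed
  then obtain c2 where c2: "(\<phi>2 \<longlongrightarrow> c2) at_top" "\<And>r. r > 0 \<Longrightarrow> \<phi>2 r \<le> c2"
    using limit_of_power_decay[OF D2 w(2)] by blast
  show thesis
  proof (rule that[OF sys _ _ _ _ c1(1) c2(1) k \<open>k > 0\<close>])
    show "\<nu> * q > \<nu> + 1 \<longrightarrow> (\<exists>k2>0. ((\<lambda>r. r powr \<nu> * w2 r) \<longlongrightarrow> k2) at_top)"
      using supercritical by blast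
    show "0 \<le> \<phi>1 r \<and> \<phi>1 r \<le> c1" "0 \<le> \<phi>2 r \<and> \<phi>2 r \<le> c2" if "r > 0" for r
      using c1(2) c2(2) that A
        profile_nonneg[OF al(1) c(1) nonneg(1), of A1 r] profile_nonneg[OF al(2) c(2) nonneg(2), of A2 r]
      by (auto simp: \<phi>1_def \<phi>2_def)
    show "((\<lambda>r. \<phi>1 r / (A1 / (1 - \<alpha>1) * r powr (1 - \<alpha>1))) \<longlongrightarrow> 1) (at_right 0)"
      "((\<lambda>r. \<phi>2 r / (A2 / (1 - \<alpha>2) * r powr (1 - \<alpha>2))) \<longlongrightarrow> 1) (at_right 0)"
      unfolding \<phi>1_def \<phi>2_def
      by (intro profile_asymptotic al c one A)+
  qed
qed

end

section \<open>The three systems in the punctured space\<close>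

lemma cusp_power:
  assumes "A > 0" "0 < \<gamma>" "\<gamma> < 1"
  shows "cusp (\<lambda>r. A * r powr \<gamma>)"
  unfolding cusp_def
proof (intro conjI exI)
  show "((\<lambda>r. A * r powr \<gamma>) \<longlongrightarrow> 0) (at_right 0)"
    using assms by real_asymp
  have "LIM r at_right 0. A * (\<gamma> * r powr (\<gamma> - 1)) :> at_top"
    using assms by real_asymp
  moreover have "\<forall>\<^sub>F r in at_right 0. A * (\<gamma> * r powr (\<gamma> - 1)) = \<bar>deriv (\<lambda>r. A * r powr \<gamma>) r\<bar>"
    using eventually_at_right_less[of 0]
  proof eventually_elim
    case (elim r)
    then have "deriv (\<lambda>r. A * r powr \<gamma>) r = A * (\<gamma> * r powr (\<gamma> - 1))"
      by (intro DERIV_imp_deriv DERIV_cmult has_real_derivative_powr)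
    then show ?case using assms by simp
  qed
  ultimately show "LIM r at_right 0. \<bar>deriv (\<lambda>r. A * r powr \<gamma>) r\<bar> :> at_top"
    by (rule filterlim_mono_eventually[OF _ order_refl order_refl])
qed

text \<open>Covers the reflections \<open>C - u\<close> and the shifts \<open>u - C\<close> at once.\<close>

lemma C2_on_affine:
  assumes "open S" "C2_on S u"
  shows "C2_on S (\<lambda>x. a + s * u x)"
    and "x \<in> S \<Longrightarrow> grad (\<lambda>x. a + s * u x) x = s *\<^sub>R grad u x"
    and "x \<in> S \<Longrightarrow> laplacian (\<lambda>x. a + s * u x) x = s * laplacian u x"
proof -
  obtain G H where G: "\<And>x. x \<in> S \<Longrightarrow> GDERIV u x :> G x"
    and H: "\<And>x. x \<in> S \<Longrightarrow> (G has_derivative H x) (at x)"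
    and cont: "\<And>v. continuous_on S (\<lambda>x. H x v)"
    using assms(2) by (auto simp: C2_on_def)
  have G': "GDERIV (\<lambda>x. a + s * u x) x :> s *\<^sub>R G x" if "x \<in> S" for x
    using has_derivative_add[OF has_derivative_const
        has_derivative_mult_right[OF G[OF that, unfolded gderiv_def]], of a s]
    by (simp add: gderiv_def)
  have H': "((\<lambda>x. s *\<^sub>R G x) has_derivative (\<lambda>h. s *\<^sub>R H x h)) (at x)" if "x \<in> S" for x
    by (rule has_derivative_scaleR_right[OF H[OF that]])
  show "C2_on S (\<lambda>x. a + s * u x)"
    unfolding C2_on_def
    by (intro exI[of _ "\<lambda>x. s *\<^sub>R G x"] exI[of _ "\<lambda>x h. s *\<^sub>R H x h"] conjI ballI allI
        G' H' continuous_on_scaleR continuous_on_const cont)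
  show "grad (\<lambda>x. a + s * u x) x = s *\<^sub>R grad u x" if "x \<in> S"
    using grad_eq[OF G'[OF that]] grad_eq[OF G[OF that]] by simp
  show "laplacian (\<lambda>x. a + s * u x) x = s * laplacian u x" if "x \<in> S"
    using laplacian_eq_trace[OF assms(1) that G' H'[OF that]]
      laplacian_eq_trace[OF assms(1) that G H[OF that]]
    by (simp add: sum_distrib_left)
qed

lemma bounded_punctured_affine:
  assumes "bounded_punctured u"
  shows "bounded_punctured (\<lambda>x. a + s * u x)"
proof -
  obtain B where "\<And>x. x \<noteq> 0 \<Longrightarrow> \<bar>u x\<bar> \<le> B"
    using assms by (auto simp: bounded_punctured_def bounded_iff)
  then have "\<bar>a + s * u x\<bar> \<le> \<bar>a\<bar> + \<bar>s\<bar> * B" if "x \<noteq> 0" for x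
    using that by (intro order_trans[OF abs_triangle_ineq]) (simp add: abs_mult mult_left_mono)
  then show ?thesis unfolding bounded_punctured_def bounded_iff by auto
qed

text \<open>Reflection changes the sign of the Laplacian and keeps the norm of the gradient.\<close>

lemma reflected_solutions:
  fixes u1 u2 :: "'a::euclidean_space \<Rightarrow> real"
  assumes "absorption_solution p q u1 u2"
    and "\<And>x. x \<noteq> 0 \<Longrightarrow> u1 x \<le> c1" "\<And>x. x \<noteq> 0 \<Longrightarrow> u2 x \<le> c2" and "C1 \<ge> c1"
  shows "C2 \<ge> c2 \<Longrightarrow> source_solution p q (\<lambda>x. C1 - u1 x) (\<lambda>x. C2 - u2 x)"
    and "C2 \<le> 0 \<Longrightarrow> mixed_solution p q (\<lambda>x. C1 - u1 x) (\<lambda>x. u2 x - C2)"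
proof -
  have C2s: "C2_on (UNIV - {0}) u1" "C2_on (UNIV - {0}) u2"
    and eq: "\<And>x. x \<noteq> 0 \<Longrightarrow> laplacian u1 x = norm (grad u2 x) powr p \<and>
      laplacian u2 x = norm (grad u1 x) powr q \<and> u1 x \<ge> 0 \<and> u2 x \<ge> 0"
    using assms(1) by (auto simp: absorption_solution_def)
  have le1: "u1 x \<le> C1" if "x \<noteq> 0" for x
    using assms(2)[OF that] assms(4) by simp
  have op: "open (UNIV - {0::'a})" by auto
  note affine1 = C2_on_affine[OF op C2s(1), where a = "C1" and s = "-1"]
  note affine2 = C2_on_affine[OF op C2s(2), where a = "C2" and s = "-1"]
  note affine3 = C2_on_affine[OF op C2s(2), where a = "- C2" and s = "1"]
  show "source_solution p q (\<lambda>x. C1 - u1 x) (\<lambda>x. C2 - u2 x)" if "C2 \<ge> c2"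
    unfolding source_solution_def
    using affine1 affine2 eq le1 order_trans[OF assms(3) that] by auto
  show "mixed_solution p q (\<lambda>x. C1 - u1 x) (\<lambda>x. u2 x - C2)" if "C2 \<le> 0"
    unfolding mixed_solution_def
    using affine1 affine3 eq le1 order_trans[OF that] by auto
qed

lemma bounded_punctured_radial:
  assumes "\<And>r. r > 0 \<Longrightarrow> \<bar>\<phi> r\<bar> \<le> B"
  shows "bounded_punctured (radial \<phi> :: real^'n \<Rightarrow> real)"
proof -
  have "\<bar>radial \<phi> x\<bar> \<le> B" if "x \<noteq> 0" for x :: "real^'n"
    using assms[of "norm x"] that by (simp add: radial_def)
  then show ?thesis unfolding bounded_punctured_def bounded_iff by auto
qed

lemma bounded_radial_profile:
  assumes "bounded_punctured (radial \<phi> :: real^'n \<Rightarrow> real)"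
  obtains B where "\<And>r. r > 0 \<Longrightarrow> \<phi> r \<le> B"
proof -
  obtain B where B: "\<And>x::real^'n. x \<noteq> 0 \<Longrightarrow> \<bar>radial \<phi> x\<bar> \<le> B"
    using assms by (auto simp: bounded_punctured_def bounded_iff)
  obtain e :: "real^'n" where "e \<in> Basis" by (meson nonempty_Basis ex_in_conv)
  then have e: "norm e = 1" "e \<noteq> 0" by auto
  have "\<phi> r \<le> B" if "r > 0" for r
    using B[of "r *\<^sub>R e"] e that by (simp add: radial_def)
  then show thesis using that by blast
qed

lemma flux_limit_deriv_iff:
  fixes \<phi> w :: "real \<Rightarrow> real"
  assumes "\<And>r. r > 0 \<Longrightarrow> (\<phi> has_real_derivative w r) (at r)"
  shows "((\<lambda>r. r powr m * deriv \<phi> r) \<longlongrightarrow> k) at_top \<longleftrightarrow> ((\<lambda>r. r powr m * w r) \<longlongrightarrow> k) at_top"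
  by (rule filterlim_cong[OF refl refl eventually_mono[OF eventually_gt_at_top[of 0]]])
     (simp add: DERIV_imp_deriv[OF assms])

text \<open>Bounded profiles with a nondecreasing flux are nondecreasing.\<close>

lemma limit_is_upper_bound:
  fixes \<phi> w W' :: "real \<Rightarrow> real"
  assumes D: "\<And>r. r > 0 \<Longrightarrow> (\<phi> has_real_derivative w r) (at r)"
    and W: "\<And>r. r > 0 \<Longrightarrow> ((\<lambda>r. r powr \<nu> * w r) has_real_derivative W' r) (at r)"
      "\<And>r. r > 0 \<Longrightarrow> W' r \<ge> 0"
    and bdd: "\<And>r. r > 0 \<Longrightarrow> \<phi> r \<le> B" and "\<nu> \<ge> 1"
    and lim: "(\<phi> \<longlongrightarrow> c) at_top" and "r > 0"
  shows "\<phi> r \<le> c"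
proof (rule tendsto_lowerbound[OF lim])
  have "w r \<ge> 0" if "r > 0" for r
    by (rule flux_nonneg[OF D W bdd \<open>\<nu> \<ge> 1\<close> that])
  then have "\<phi> r \<le> \<phi> s" if "r \<le> s" for s
    using mono_from_derivative[OF D _ \<open>r > 0\<close> that] by blast
  then show "\<forall>\<^sub>F s in at_top. \<phi> r \<le> \<phi> s"
    unfolding eventually_at_top_linorder by blast
qed simp

text \<open>The equivalence at the origin excludes a profile that vanishes identically near \<open>0\<close>.\<close>

lemma positive_limit:
  fixes \<phi> u :: "real \<Rightarrow> real"
  assumes "((\<lambda>r. \<phi> r / u r) \<longlongrightarrow> 1) (at_right 0)" "\<And>r. r > 0 \<Longrightarrow> 0 \<le> \<phi> r \<and> \<phi> r \<le> c"
  shows "c > 0"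
proof -
  have "\<forall>\<^sub>F r in at_right 0. 0 < \<phi> r / u r"
    by (rule order_tendstoD(1)[OF assms(1)]) simp
  then have "\<forall>\<^sub>F r in at_right 0. r > 0 \<and> 0 < \<phi> r / u r"
    using eventually_at_right_less[of 0] by eventually_elim simp
  from eventually_happens'[OF trivial_limit_at_right_real this]
  obtain r where r: "r > 0" "0 < \<phi> r / u r" by blast
  then have "\<phi> r \<noteq> 0" by auto
  with r(1) assms(2)[of r] show ?thesis by linarith
qed

text \<open>The condition \<open>q > (p + 2) / p\<close> says \<open>p (q - 1) > 2\<close>; since \<open>q \<le> p\<close> it forces \<open>p > 2\<close>.\<close>

lemma parameter_ranges:
  fixes p q :: real
  assumes "p \<ge> q" "q > 0" "q > q4 p"
  shows "q > 1" "p > 2" "p * q - p > 2"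
proof -
  have p: "p > 0" using assms by simp
  then have "1 < q4 p" by (simp add: q4_def)
  then show q: "q > 1" using assms(3) by simp
  show pq: "p * q - p > 2" using assms(3) p by (simp add: q4_def field_simps)
  show "p > 2"
  proof (rule ccontr)
    assume "\<not> p > 2"
    then have "p * (q - 1) \<le> 2 * 1" using assms(1) q by (intro mult_mono) auto
    with pq show False by (simp add: algebra_simps)
  qed
qed

lemma balance_constants:
  fixes B1 B2 p q :: real
  assumes "B1 > 0" "B2 > 0" "p * q > 1"
  shows "(B1 * B2 powr p) powr (1 / (p * q - 1)) * B1 = ((B2 * B1 powr q) powr (1 / (p * q - 1))) powr p"
proof -
  define e where "e = 1 / (p * q - 1)"
  have e: "p * q * e = e + 1" using assms(3) by (simp add: e_def field_simps)
  have "(B1 * B2 powr p) powr e * B1 = B1 powr (e + 1) * B2 powr (p * e)"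
    using assms by (simp add: powr_mult powr_powr powr_add)
  also have "\<dots> = ((B2 * B1 powr q) powr e) powr p"
    using assms by (simp add: powr_mult powr_powr e[symmetric] mult_ac)
  finally show ?thesis by (simp add: e_def)
qed

lemma similarity_constants:
  fixes p q :: real and N :: nat
  assumes "N \<ge> 3" "p \<ge> q" "q > 0" "q > q4 p"
  shows "similarity (real N - 1) p q ((p + 1) / (p * q - 1)) ((q + 1) / (p * q - 1)) (a1 N p q) (a2 N p q)"
proof -
  note r = parameter_ranges[OF assms(2-4)]
  define D where "D = p * q - 1"
  have D: "D > 0" "p * q = D + 1" "p + 1 < D" "q + 1 < D" using r assms(2) by (auto simp: D_def)
  have N: "real N - 1 \<ge> 2" using assms(1) by simp
  have al: "(p + 1) / D < 1" "(q + 1) / D < 1" using D by simp_all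
  have b1: "- beta1 N p q = real N - 1 - (p + 1) / D"
    using D(1) unfolding beta1_def mult.assoc D_def[symmetric] D(2) by (simp add: field_simps)
  have b2: "- beta2 N p q = real N - 1 - (q + 1) / D"
    using D(1) unfolding beta2_def mult.assoc D_def[symmetric] D(2) by (simp add: field_simps)
  have pos: "- beta1 N p q > 0" "- beta2 N p q > 0" using b1 b2 al N by simp_all
  then have abs: "\<bar>beta1 N p q\<bar> = - beta1 N p q" "\<bar>beta2 N p q\<bar> = - beta2 N p q" by simp_all
  show ?thesis
    unfolding D_def[symmetric]
  proof
    have "2 * 1 \<le> (real N - 1) * (p - 1)" using N r by (intro mult_mono) auto
    then show "(real N - 1) * (p - 1) > 1" by simp
    show "p * ((q + 1) / D) = (p + 1) / D + 1" "q * ((p + 1) / D) = (q + 1) / D + 1"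
      using D by (simp_all add: field_simps)
    show "a1 N p q > 0" "a2 N p q > 0" using pos by (simp_all add: a1_def a2_def)
    show "a1 N p q * (real N - 1 - (p + 1) / D) = a2 N p q powr p"
      using balance_constants[OF pos, of p q] D unfolding b1[symmetric] a1_def a2_def abs by simp
    show "a2 N p q * (real N - 1 - (q + 1) / D) = a1 N p q powr q"
      using balance_constants[OF pos(2,1), of q p] D unfolding b2[symmetric] a1_def a2_def abs
      by (simp add: mult.commute)
  qed (use r N al in auto)
qed

lemma u_star_eq:
  fixes p q :: real
  assumes "N \<ge> 3" "p \<ge> q" "q > 0" "q > q4 p"
  shows "u1star N p q = (\<lambda>r. a1 N p q / (1 - (p + 1) / (p * q - 1)) * r powr (1 - (p + 1) / (p * q - 1)))"
    and "u2star N p q = (\<lambda>r. a2 N p q / (1 - (q + 1) / (p * q - 1)) * r powr (1 - (q + 1) / (p * q - 1)))"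
    and "0 < 1 - (p + 1) / (p * q - 1)" "1 - (p + 1) / (p * q - 1) < 1"
    and "0 < 1 - (q + 1) / (p * q - 1)" "1 - (q + 1) / (p * q - 1) < 1"
    and "a1 N p q > 0" "a2 N p q > 0"
proof -
  note r = parameter_ranges[OF assms(2-4)]
  interpret similarity "real N - 1" p q "(p + 1) / (p * q - 1)" "(q + 1) / (p * q - 1)" "a1 N p q" "a2 N p q"
    by (rule similarity_constants[OF assms])
  show "a1 N p q > 0" "a2 N p q > 0" by (rule A)+
  have D: "p * q - 1 > 0" using r by simp
  show "0 < 1 - (p + 1) / (p * q - 1)" "0 < 1 - (q + 1) / (p * q - 1)" using al by simp_all
  show "1 - (p + 1) / (p * q - 1) < 1" "1 - (q + 1) / (p * q - 1) < 1"
    using r assms D by simp_all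
  have e: "1 - (p + 1) / (p * q - 1) = (p * (q - 1) - 2) / (p * q - 1)"
    "1 - (q + 1) / (p * q - 1) = (q * (p - 1) - 2) / (p * q - 1)"
    using D by (simp_all add: field_simps)
  have pos: "p * (q - 1) - 2 > 0" "q * (p - 1) - 2 > 0"
    using r assms(2) by (simp_all add: algebra_simps)
  show "u1star N p q = (\<lambda>r. a1 N p q / (1 - (p + 1) / (p * q - 1)) * r powr (1 - (p + 1) / (p * q - 1)))"
    "u2star N p q = (\<lambda>r. a2 N p q / (1 - (q + 1) / (p * q - 1)) * r powr (1 - (q + 1) / (p * q - 1)))"
    unfolding e u1star_def u2star_def A1star_def A2star_def using pos D A
    by (simp_all add: fun_eq_iff abs_mult)
qed

lemma particular_solution:
  fixes p q :: real
  assumes "N = CARD('n::finite)" "N \<ge> 3" "p \<ge> q" "q > 0" "q > q4 p"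
  shows "absorption_solution p q (radial (u1star N p q) :: real^'n \<Rightarrow> real) (radial (u2star N p q))"
proof -
  interpret similarity "real N - 1" p q "(p + 1) / (p * q - 1)" "(q + 1) / (p * q - 1)" "a1 N p q" "a2 N p q"
    by (rule similarity_constants[OF assms(2-5)])
  note u = u_star_eq[OF assms(2-5)]
  have "\<exists>w1 w2. radial_system (real CARD('n) - 1) p q (u1star N p q) (u2star N p q) w1 w2"
    using particular_system unfolding u(1,2) assms(1)[symmetric] by blast
  moreover have "\<forall>r>0. u1star N p q r \<ge> 0 \<and> u2star N p q r \<ge> 0"
    by (simp add: u1star_def u2star_def A1star_def A2star_def)
  ultimately show ?thesis
    using radial_absorption_iff[where ?'n = 'n, of p q "u1star N p q" "u2star N p q"] assms p1 q1 by simp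
qed

text \<open>The limit of the second flux is determined by that of the first for every solution, so \<open>c(k\<^sub>1)\<close> does not depend
  on the solution.\<close>

lemma subcritical_rate_constant:
  fixes p q :: real
  assumes "N = CARD('n::finite)" "N \<ge> 3" "p > 0" "q > 0" "q < real N / (real N - 1)"
    and "absorption_solution p q (radial \<phi>1 :: real^'n \<Rightarrow> real) (radial \<phi>2)"
    and "asymptotics N p q ((real N - 1) * q - 1) \<phi>1 \<phi>2 c1 c2 k1 k2"
  shows "k2 = k1 powr q / (real N - (real N - 1) * q)"
proof -
  obtain w1 w2 where sys: "radial_system (real N - 1) p q \<phi>1 \<phi>2 w1 w2"
    using assms(1,3,4,6) radial_absorption_iff[where ?'n = 'n, of p q \<phi>1 \<phi>2] by blast
  have D: "(\<phi>1 has_real_derivative w1 r) (at r)" "(\<phi>2 has_real_derivative w2 r) (at r)"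
    and W2: "((\<lambda>r. r powr (real N - 1) * w2 r) has_real_derivative
        r powr (real N - 1) * \<bar>w1 r\<bar> powr q) (at r)" if "r > 0" for r
    using sys that by (auto simp: radial_system_def)
  have lim: "((\<lambda>r. r powr (real N - 1) * w1 r) \<longlongrightarrow> k1) at_top"
      "((\<lambda>r. r powr ((real N - 1) * q - 1) * w2 r) \<longlongrightarrow> k2) at_top" and "k1 > 0"
    using assms(7) by (auto simp: asymptotics_def flux_limit_deriv_iff[OF D(1)] flux_limit_deriv_iff[OF D(2)])
  have "real N - 1 > 0" using assms(2) by simp
  then have "(real N - 1) + 1 - (real N - 1) * q > 0"
    using assms(5) by (simp add: field_simps)
  from second_flux_limit[OF W2 lim(1) \<open>k1 > 0\<close> this]
  have "((\<lambda>r. r powr ((real N - 1) * q - 1) * w2 r) \<longlongrightarrow> k1 powr q / (real N - (real N - 1) * q)) at_top"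
    by simp
  with lim(2) show ?thesis
    by (rule tendsto_unique[OF trivial_limit_at_top_linorder])
qed

lemma bounded_solution_exists:
  fixes p q :: real
  assumes "N = CARD('n::finite)" "N \<ge> 3" "p \<ge> q" "q > 0" "q > q4 p" "q \<noteq> real N / (real N - 1)"
  obtains \<phi>1 \<phi>2 c1 c2 k1 k2 where
    "absorption_solution p q (radial \<phi>1 :: real^'n \<Rightarrow> real) (radial \<phi>2)"
    "bounded_punctured (radial \<phi>1 :: real^'n \<Rightarrow> real)" "bounded_punctured (radial \<phi>2 :: real^'n \<Rightarrow> real)"
    "asymptotics N p q (rate N q) \<phi>1 \<phi>2 c1 c2 k1 k2"
proof -
  interpret similarity "real N - 1" p q "(p + 1) / (p * q - 1)" "(q + 1) / (p * q - 1)" "a1 N p q" "a2 N p q"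
    by (rule similarity_constants[OF assms(2-5)])
  note u = u_star_eq[OF assms(2-5)]
  have N: "real N - 1 > 0" using assms(2) by simp
  have crit: "q < real N / (real N - 1) \<longleftrightarrow> (real N - 1) * q < real N - 1 + 1"
    "q = real N / (real N - 1) \<longleftrightarrow> (real N - 1) * q = real N - 1 + 1"
    using N by (auto simp: field_simps)
  have nc: "(real N - 1) * q \<noteq> real N - 1 + 1" using assms(6) crit(2) by simp
  obtain \<phi>1 \<phi>2 w1 w2 c1 c2 k where sys: "radial_system (real N - 1) p q \<phi>1 \<phi>2 w1 w2"
    and b1: "\<And>r. r > 0 \<Longrightarrow> 0 \<le> \<phi>1 r \<and> \<phi>1 r \<le> c1" and b2: "\<And>r. r > 0 \<Longrightarrow> 0 \<le> \<phi>2 r \<and> \<phi>2 r \<le> c2"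
    and l0': "((\<lambda>r. \<phi>1 r / (a1 N p q / (1 - (p + 1) / (p * q - 1)) * r powr (1 - (p + 1) / (p * q - 1))))
        \<longlongrightarrow> 1) (at_right 0)"
      "((\<lambda>r. \<phi>2 r / (a2 N p q / (1 - (q + 1) / (p * q - 1)) * r powr (1 - (q + 1) / (p * q - 1))))
        \<longlongrightarrow> 1) (at_right 0)"
    and l: "(\<phi>1 \<longlongrightarrow> c1) at_top" "(\<phi>2 \<longlongrightarrow> c2) at_top"
    and k: "((\<lambda>r. r powr (real N - 1) * w1 r) \<longlongrightarrow> k) at_top" "k > 0"
    and super: "(real N - 1) * q > real N - 1 + 1 \<longrightarrow>
      (\<exists>k2>0. ((\<lambda>r. r powr (real N - 1) * w2 r) \<longlongrightarrow> k2) at_top)"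
    by (rule crossing_solution[OF nc]) (rule that)
  have l0: "((\<lambda>r. \<phi>1 r / u1star N p q r) \<longlongrightarrow> 1) (at_right 0)"
      "((\<lambda>r. \<phi>2 r / u2star N p q r) \<longlongrightarrow> 1) (at_right 0)"
    unfolding u(1,2) by (rule l0')+
  have D: "(\<phi>1 has_real_derivative w1 r) (at r)" "(\<phi>2 has_real_derivative w2 r) (at r)"
    and W2: "((\<lambda>r. r powr (real N - 1) * w2 r) has_real_derivative
        r powr (real N - 1) * \<bar>w1 r\<bar> powr q) (at r)" if "r > 0" for r
    using sys that by (auto simp: radial_system_def)
  obtain k2 where k2: "((\<lambda>r. r powr rate N q * w2 r) \<longlongrightarrow> k2) at_top" "k2 > 0"
  proof (cases "q < real N / (real N - 1)")
    case True
    then have "real N - 1 + 1 - (real N - 1) * q > 0" using crit(1) by simp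
    from second_flux_limit[OF W2 k this] this k(2) that show thesis
      using True by (simp add: rate_def)
  next
    case False
    then have "(real N - 1) * q > real N - 1 + 1" using crit(1) nc by linarith
    with super that False show thesis by (auto simp: rate_def)
  qed
  have flux: "((\<lambda>r. r powr (real N - 1) * deriv \<phi>1 r) \<longlongrightarrow> k) at_top"
      "((\<lambda>r. r powr rate N q * deriv \<phi>2 r) \<longlongrightarrow> k2) at_top"
    using flux_limit_deriv_iff[OF D(1)] flux_limit_deriv_iff[OF D(2)] k(1) k2(1) by blast+
  have c: "c1 > 0" "c2 > 0"
    by (rule positive_limit[OF l0(1) b1] positive_limit[OF l0(2) b2]; assumption)+
  show thesis
  proof (rule that)
    show "absorption_solution p q (radial \<phi>1 :: real^'n \<Rightarrow> real) (radial \<phi>2)"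
      using radial_absorption_iff[where ?'n = 'n, of p q \<phi>1 \<phi>2] sys b1 b2 p1 q1 assms(1) by fastforce
    show "bounded_punctured (radial \<phi>1 :: real^'n \<Rightarrow> real)" "bounded_punctured (radial \<phi>2 :: real^'n \<Rightarrow> real)"
      by (rule bounded_punctured_radial[of _ c1] bounded_punctured_radial[of _ c2], use b1 b2 in force)+
    show "asymptotics N p q (rate N q) \<phi>1 \<phi>2 c1 c2 k k2"
      unfolding asymptotics_def using l0 l k(2) k2(2) flux by (intro conjI c)
  qed
qed

lemma profiles_below_limits:
  fixes p q :: real
  assumes "N = CARD('n::finite)" "N \<ge> 3" "p > 0" "q > 0"
    and sol: "absorption_solution p q (radial \<phi>1 :: real^'n \<Rightarrow> real) (radial \<phi>2)"
    and bdd: "bounded_punctured (radial \<phi>1 :: real^'n \<Rightarrow> real)" "bounded_punctured (radial \<phi>2 :: real^'n \<Rightarrow> real)"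
    and lim: "(\<phi>1 \<longlongrightarrow> c1) at_top" "(\<phi>2 \<longlongrightarrow> c2) at_top" and "r > 0"
  shows "\<phi>1 r \<le> c1" "\<phi>2 r \<le> c2"
proof -
  obtain w1 w2 where sys: "radial_system (real N - 1) p q \<phi>1 \<phi>2 w1 w2"
    using assms(1,3,4) sol radial_absorption_iff[where ?'n = 'n, of p q \<phi>1 \<phi>2] by blast
  have D: "(\<phi>1 has_real_derivative w1 r) (at r)" "(\<phi>2 has_real_derivative w2 r) (at r)"
    and W: "((\<lambda>r. r powr (real N - 1) * w1 r) has_real_derivative
        r powr (real N - 1) * \<bar>w2 r\<bar> powr p) (at r)"
      "((\<lambda>r. r powr (real N - 1) * w2 r) has_real_derivative
        r powr (real N - 1) * \<bar>w1 r\<bar> powr q) (at r)" if "r > 0" for r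
    using sys that by (auto simp: radial_system_def)
  have N: "real N - 1 \<ge> 1" using assms(2) by simp
  obtain B1 B2 where B: "\<And>r. r > 0 \<Longrightarrow> \<phi>1 r \<le> B1" "\<And>r. r > 0 \<Longrightarrow> \<phi>2 r \<le> B2"
    using bounded_radial_profile[OF bdd(1)] bounded_radial_profile[OF bdd(2)] by metis
  show "\<phi>1 r \<le> c1"
    by (rule limit_is_upper_bound[OF D(1) W(1) _ B(1) N lim(1) \<open>r > 0\<close>]) simp_all
  show "\<phi>2 r \<le> c2"
    by (rule limit_is_upper_bound[OF D(2) W(2) _ B(2) N lim(2) \<open>r > 0\<close>]) simp_all
qed

theorem theorem5p15:
  fixes p q :: real and N :: nat
  assumes "N = CARD('n::finite)" and "N \<ge> 3"
    and "p \<ge> q" and "q > 0" and "p * q > 1"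
    and "q > q4 p" and "q \<noteq> real N / (real N - 1)"
  shows
    "(absorption_solution p q (radial (u1star N p q) :: real^'n \<Rightarrow> real) (radial (u2star N p q))
        \<and> cusp (u1star N p q) \<and> cusp (u2star N p q)) \<and>
     (q < real N / (real N - 1) \<longrightarrow>
        (\<exists>c :: real \<Rightarrow> real. (\<forall>k>0. c k > 0) \<and>
           (\<exists>\<phi>1 \<phi>2 c1 c2 k1.
              absorption_solution p q (radial \<phi>1 :: real^'n \<Rightarrow> real) (radial \<phi>2) \<and>
              bounded_punctured (radial \<phi>1 :: real^'n \<Rightarrow> real) \<and>
              bounded_punctured (radial \<phi>2 :: real^'n \<Rightarrow> real) \<and>
              asymptotics N p q ((real N - 1) * q - 1) \<phi>1 \<phi>2 c1 c2 k1 (c k1)) \<and>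
           (\<forall>\<phi>1 \<phi>2 c1 c2 k1 k2.
              absorption_solution p q (radial \<phi>1 :: real^'n \<Rightarrow> real) (radial \<phi>2) \<and>
              bounded_punctured (radial \<phi>1 :: real^'n \<Rightarrow> real) \<and>
              bounded_punctured (radial \<phi>2 :: real^'n \<Rightarrow> real) \<and>
              asymptotics N p q ((real N - 1) * q - 1) \<phi>1 \<phi>2 c1 c2 k1 k2 \<longrightarrow> k2 = c k1))) \<and>
     (q > max (q4 p) (real N / (real N - 1)) \<longrightarrow>
        (\<exists>\<phi>1 \<phi>2 c1 c2 k1 k2.
              absorption_solution p q (radial \<phi>1 :: real^'n \<Rightarrow> real) (radial \<phi>2) \<and>
              bounded_punctured (radial \<phi>1 :: real^'n \<Rightarrow> real) \<and>
              bounded_punctured (radial \<phi>2 :: real^'n \<Rightarrow> real) \<and>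
              asymptotics N p q (real N - 1) \<phi>1 \<phi>2 c1 c2 k1 k2)) \<and>
     (\<forall>\<phi>1 \<phi>2 c1 c2 k1 k2.
        absorption_solution p q (radial \<phi>1 :: real^'n \<Rightarrow> real) (radial \<phi>2) \<and>
        bounded_punctured (radial \<phi>1 :: real^'n \<Rightarrow> real) \<and>
        bounded_punctured (radial \<phi>2 :: real^'n \<Rightarrow> real) \<and>
        asymptotics N p q (rate N q) \<phi>1 \<phi>2 c1 c2 k1 k2 \<longrightarrow>
        (\<forall>C1 C2. C1 > c1 \<and> C2 > c2 \<longrightarrow>
           source_solution p q (\<lambda>x::real^'n. C1 - radial \<phi>1 x) (\<lambda>x. C2 - radial \<phi>2 x) \<and>
           bounded_punctured (\<lambda>x::real^'n. C1 - radial \<phi>1 x) \<and>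
           bounded_punctured (\<lambda>x::real^'n. C2 - radial \<phi>2 x)) \<and>
        (\<forall>C1 C2. C1 > c1 \<and> C2 < 0 \<longrightarrow>
           (\<exists>v1 v2 :: real^'n \<Rightarrow> real.
              (\<forall>x. (v1 x, - v2 x) = (C1 - radial \<phi>1 x, C2 - radial \<phi>2 x)) \<and>
              mixed_solution p q v1 v2 \<and> bounded_punctured v1 \<and> bounded_punctured v2)))"
proof (intro conjI impI)
  note basic = assms(2-4) assms(6)
  note r = parameter_ranges[OF assms(3,4,6)]
  note u = u_star_eq[OF basic]
  show "absorption_solution p q (radial (u1star N p q) :: real^'n \<Rightarrow> real) (radial (u2star N p q))"
    by (rule particular_solution[OF assms(1) basic])
  show "cusp (u1star N p q)" "cusp (u2star N p q)"
    unfolding u(1,2) by (rule cusp_power; use u(3-8) in simp)+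
next
  note basic = assms(2-4) assms(6)
  note r = parameter_ranges[OF assms(3,4,6)]
  assume sub: "q < real N / (real N - 1)"
  then have rate: "rate N q = (real N - 1) * q - 1" by (simp add: rate_def)
  let ?c = "\<lambda>k. k powr q / (real N - (real N - 1) * q)"
  have "real N - (real N - 1) * q > 0"
    using sub assms(2) by (simp add: field_simps)
  then have pos: "\<forall>k>0. ?c k > 0" by simp
  have unique: "k2 = ?c k1"
    if "absorption_solution p q (radial \<phi>1 :: real^'n \<Rightarrow> real) (radial \<phi>2)"
      "asymptotics N p q ((real N - 1) * q - 1) \<phi>1 \<phi>2 c1 c2 k1 k2" for \<phi>1 \<phi>2 c1 c2 k1 k2
    by (rule subcritical_rate_constant[OF assms(1,2) _ assms(4) sub that]) (use r in simp)
  obtain \<phi>1 \<phi>2 c1 c2 k1 k2 where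
    sol: "absorption_solution p q (radial \<phi>1 :: real^'n \<Rightarrow> real) (radial \<phi>2)"
    "bounded_punctured (radial \<phi>1 :: real^'n \<Rightarrow> real)" "bounded_punctured (radial \<phi>2 :: real^'n \<Rightarrow> real)"
    and asy: "asymptotics N p q ((real N - 1) * q - 1) \<phi>1 \<phi>2 c1 c2 k1 k2"
    using bounded_solution_exists[OF assms(1) basic assms(7)] unfolding rate by metis
  have "k2 = ?c k1" by (rule unique[OF sol(1) asy])
  with asy have asy': "asymptotics N p q ((real N - 1) * q - 1) \<phi>1 \<phi>2 c1 c2 k1 (?c k1)" by simp
  show "\<exists>c :: real \<Rightarrow> real. (\<forall>k>0. c k > 0) \<and>
           (\<exists>\<phi>1 \<phi>2 c1 c2 k1.
              absorption_solution p q (radial \<phi>1 :: real^'n \<Rightarrow> real) (radial \<phi>2) \<and>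
              bounded_punctured (radial \<phi>1 :: real^'n \<Rightarrow> real) \<and>
              bounded_punctured (radial \<phi>2 :: real^'n \<Rightarrow> real) \<and>
              asymptotics N p q ((real N - 1) * q - 1) \<phi>1 \<phi>2 c1 c2 k1 (c k1)) \<and>
           (\<forall>\<phi>1 \<phi>2 c1 c2 k1 k2.
              absorption_solution p q (radial \<phi>1 :: real^'n \<Rightarrow> real) (radial \<phi>2) \<and>
              bounded_punctured (radial \<phi>1 :: real^'n \<Rightarrow> real) \<and>
              bounded_punctured (radial \<phi>2 :: real^'n \<Rightarrow> real) \<and>
              asymptotics N p q ((real N - 1) * q - 1) \<phi>1 \<phi>2 c1 c2 k1 k2 \<longrightarrow> k2 = c k1)"
    by (rule exI[of _ ?c], rule conjI[OF pos], rule conjI) (use sol asy' unique in blast)+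
next
  note basic = assms(2-4) assms(6)
  assume "q > max (q4 p) (real N / (real N - 1))"
  then have rate: "rate N q = real N - 1" by (simp add: rate_def)
  show "\<exists>\<phi>1 \<phi>2 c1 c2 k1 k2.
              absorption_solution p q (radial \<phi>1 :: real^'n \<Rightarrow> real) (radial \<phi>2) \<and>
              bounded_punctured (radial \<phi>1 :: real^'n \<Rightarrow> real) \<and>
              bounded_punctured (radial \<phi>2 :: real^'n \<Rightarrow> real) \<and>
              asymptotics N p q (real N - 1) \<phi>1 \<phi>2 c1 c2 k1 k2"
    using bounded_solution_exists[OF assms(1) basic assms(7)] unfolding rate by metis
next
  note basic = assms(2-4) assms(6)
  note r = parameter_ranges[OF assms(3,4,6)]
  show "\<forall>\<phi>1 \<phi>2 c1 c2 k1 k2.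
        absorption_solution p q (radial \<phi>1 :: real^'n \<Rightarrow> real) (radial \<phi>2) \<and>
        bounded_punctured (radial \<phi>1 :: real^'n \<Rightarrow> real) \<and>
        bounded_punctured (radial \<phi>2 :: real^'n \<Rightarrow> real) \<and>
        asymptotics N p q (rate N q) \<phi>1 \<phi>2 c1 c2 k1 k2 \<longrightarrow>
        (\<forall>C1 C2. C1 > c1 \<and> C2 > c2 \<longrightarrow>
           source_solution p q (\<lambda>x::real^'n. C1 - radial \<phi>1 x) (\<lambda>x. C2 - radial \<phi>2 x) \<and>
           bounded_punctured (\<lambda>x::real^'n. C1 - radial \<phi>1 x) \<and>
           bounded_punctured (\<lambda>x::real^'n. C2 - radial \<phi>2 x)) \<and>
        (\<forall>C1 C2. C1 > c1 \<and> C2 < 0 \<longrightarrow>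
           (\<exists>v1 v2 :: real^'n \<Rightarrow> real.
              (\<forall>x. (v1 x, - v2 x) = (C1 - radial \<phi>1 x, C2 - radial \<phi>2 x)) \<and>
              mixed_solution p q v1 v2 \<and> bounded_punctured v1 \<and> bounded_punctured v2))"
  proof (intro allI impI, elim conjE, intro conjI allI impI)
    fix \<phi>1 \<phi>2 c1 c2 k1 k2
    assume sol: "absorption_solution p q (radial \<phi>1 :: real^'n \<Rightarrow> real) (radial \<phi>2)"
      and bdd: "bounded_punctured (radial \<phi>1 :: real^'n \<Rightarrow> real)" "bounded_punctured (radial \<phi>2 :: real^'n \<Rightarrow> real)"
      and asy: "asymptotics N p q (rate N q) \<phi>1 \<phi>2 c1 c2 k1 k2"
    have lim: "(\<phi>1 \<longlongrightarrow> c1) at_top" "(\<phi>2 \<longlongrightarrow> c2) at_top"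
      using asy by (auto simp: asymptotics_def)
    have p: "p > 0" using r by simp
    have le: "radial \<phi>1 x \<le> c1" "radial \<phi>2 x \<le> c2" if "x \<noteq> 0" for x :: "real^'n"
      using profiles_below_limits[OF assms(1,2) p assms(4) sol bdd lim, of "norm x"] that
      by (simp_all add: radial_def)
    have b: "bounded_punctured (\<lambda>x::real^'n. C - radial \<phi>1 x)"
        "bounded_punctured (\<lambda>x::real^'n. C - radial \<phi>2 x)"
        "bounded_punctured (\<lambda>x::real^'n. radial \<phi>2 x - C)" for C
      using bounded_punctured_affine[OF bdd(1), of C "-1"]
        bounded_punctured_affine[OF bdd(2), of C "-1"] bounded_punctured_affine[OF bdd(2), of "-C" 1]
      by simp_all
    { fix C1 C2 :: real assume "C1 > c1 \<and> C2 > c2"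
      then show "source_solution p q (\<lambda>x::real^'n. C1 - radial \<phi>1 x) (\<lambda>x. C2 - radial \<phi>2 x)"
        using reflected_solutions(1)[OF sol le, of C1 C2] by simp
      show "bounded_punctured (\<lambda>x::real^'n. C1 - radial \<phi>1 x)"
        "bounded_punctured (\<lambda>x::real^'n. C2 - radial \<phi>2 x)" by (rule b)+ }
    fix C1 C2 :: real assume "C1 > c1 \<and> C2 < 0"
    then have "mixed_solution p q (\<lambda>x::real^'n. C1 - radial \<phi>1 x) (\<lambda>x. radial \<phi>2 x - C2)"
      using reflected_solutions(2)[OF sol le, of C1 C2] by simp
    then show "\<exists>v1 v2 :: real^'n \<Rightarrow> real.
              (\<forall>x. (v1 x, - v2 x) = (C1 - radial \<phi>1 x, C2 - radial \<phi>2 x)) \<and>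
              mixed_solution p q v1 v2 \<and> bounded_punctured v1 \<and> bounded_punctured v2"
      using b by (intro exI conjI) auto
  qed
qed

end
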